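(* Let $A\in\mathbb{R}^{M\times N}$, $y\in\mathbb{R}^M$, $\sigma_{\mathrm{rp}},\sigma_{\mathrm{link}}:\mathbb{R}\to\mathbb{R}$ (acting entry-wise on vectors) and $L:\mathbb{R}^M\times\mathbb{R}^M\to\mathbb{R}$ satisfy (A1)–(A5) (listed in the context), and set $$\mathcal{L}(z)=L\big(\sigma_{\mathrm{link}}(A\sigma_{\mathrm{rp}}(z)),y\big),\qquad \widetilde{\mathcal{L}}(\widetilde z)=L\big(\sigma_{\mathrm{link}}(A\widetilde z),y\big)\qquad(z,\widetilde z\in\mathbb{R}^N).$$ Let $T\in\mathbb{R}_{>0}\cup\{+\infty\}$ and let $w:[0,T)\to\mathbb{R}^N$ be any regular solution of $w'(t)=-\nabla\mathcal{L}(w(t))$, $w(0)=w_0$, with $w_0\in\mathbb{R}^N$. Put $\widetilde w(t)=\sigma_{\mathrm{rp}}(w(t))$, $\widetilde w_0=\sigma_{\mathrm{rp}}(w_0)$. Let $h$, $H$, $F$, $D_F$ be as defined in the context. Then: (i) (General convergence rate) For all $t\in(0,T)$, $$\widetilde{\mathcal{L}}(\widetilde w(t))\le\frac{D_F(\widetilde z_0,\widetilde w_0)}{t},$$ where $\widetilde z_0$ is chosen as in (A4), and $D_F(\widetilde z_0,\widetilde w_0)<\infty$. If $T=\infty$, this implies $\lim_{t\to\infty}\widetilde{\mathcal{L}}(\widetilde w(t))=0$. (ii) (Linear convergence rate) Let $T_\circ=\{t\in[0,T):\sigma_{\mathrm{rp}}'(w(t)_i)=0\text{ for some }i\in\{1,\dots,N\}\}$.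 If, in addition, the function $v\mapsto L(\sigma_{\mathrm{link}}(v),y)$ on $\mathbb{R}^M$ satisfies the Polyak–Lojasiewicz inequality with $\mu>0$, and if there exists $r>0$ such that $1/h'(\widetilde w(t)_i)\ge r$ for every $i\in\{1,\dots,N\}$ and every $t\in[t_0,t_1)$, where $t_0,t_1\in[0,T)\cup\{\infty\}$ satisfy $[t_0,t_1)\cap T_\circ=\emptyset$, then for every $t\in[t_0,t_1)$ $$\widetilde{\mathcal{L}}(\widetilde w(t))\le\widetilde{\mathcal{L}}(\widetilde w(t_0))\,e^{-2r\mu(t-t_0)}.$$ (iii) (Extending a bounded trajectory) If $\sup_{t\in[0,T)}\|\widetilde w(t)\|_2<+\infty$, then $\widetilde w_T:=\lim_{t\to T}\widetilde w(t)$ exists. Moreover, either $\widetilde w_T\in\partial\mathcal{D}_{\mathrm{rp}}^N$ and the trajectory is maximal, or there exists $\varepsilon>0$ such that $w$ can be extended to a solution $w:[0,T+\varepsilon)\to\mathbb{R}^N$ of the gradient flow equation. (iv) (Convergence of bounded trajectory) If $T=\infty$ and $\sup_{t\ge0}\|\widetilde w(t)\|_2<+\infty$, then $\widetilde w_\infty:=\lim_{t\to+\infty}\widetilde w(t)\in\overline{\mathcal{D}_{\mathrm{rp}}^N}$ exists and $\widetilde{\mathcal{L}}(\widetilde w_\infty)=0$. (v) (Boundedness of trajectory) Suppose $\mathcal{D}_{\mathrm{rp}}$ is unbounded. If the Bregman balls $B_{D_F,r}(x)=\{z\in\mathcal{D}_{\mathrm{rp}}^N: D_F(x,z)\le r\}$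 are bounded with respect to $\|\cdot\|_2$ for any $x\in\mathcal{D}_{\mathrm{rp}}^N$ and $r\ge0$, then $\sup_{t\in[0,T)}\|\widetilde w(t)\|_2<+\infty$. In particular, the Bregman balls $B_{D_F,r}(x)$ are bounded if the univariate function $\widetilde z\mapsto\widetilde z\cdot h'(\widetilde z)$ belongs to $$\mathcal{F}_{\mathcal{D}_{\mathrm{rp}}}=\Big\{f\in L_1^c(\mathcal{D}_{\mathrm{rp}}):\Big|\int_z^b f(x)\,dx\Big|=\infty\text{ for any }z\in\mathcal{D}_{\mathrm{rp}}\text{ and }b\in\mathcal{D}_{\mathrm{rp}}^{\lim}\Big\},$$ where $\mathcal{D}_{\mathrm{rp}}^{\lim}:=\{\inf\mathcal{D}_{\mathrm{rp}},\sup\mathcal{D}_{\mathrm{rp}}\}\cap\{-\infty,\infty\}$.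
   Context: Scalar functions act entry-wise on vectors; $\mathbf 1$ is the all-ones vector. Assumptions: (A1) $\sigma_{\mathrm{link}}:\mathbb{R}\to\mathbb{R}$ is continuously differentiable and injective, and $y\in\sigma_{\mathrm{link}}(\mathbb{R}^M)$. (A2) There is an interval $\mathcal{D}_{\mathrm{rp}}\subset\mathbb{R}$ such that $\sigma_{\mathrm{rp}}:\mathbb{R}\to\mathcal{D}_{\mathrm{rp}}$ is invertible and continuously differentiable, and $\sigma_{\mathrm{rp}}'(x)\neq0$ almost everywhere. Furthermore $([\sigma_{\mathrm{rp}}^{-1}]')^2\in L_1^c(\mathcal{D}_{\mathrm{rp}})=\{f: f|_C\in L_1(C)\text{ for every compact }C\subset\mathcal{D}_{\mathrm{rp}}\}$, where $([\sigma_{\mathrm{rp}}^{-1}]')^2$ is defined almost everywhere on $\mathcal{D}_{\mathrm{rp}}$. (A3) $L$ is continuously differentiable, convex in the first argument, $\min L=0$, and $L(z,z')=\min L$ if and only if $z=z'$. (A4) There exists $\widetilde z_0\in\mathcal{D}_{\mathrm{rp}}^N$ with $\sigma_{\mathrm{link}}(A\widetilde z_0)=y$. (A5) The function $v\mapsto L(\sigma_{\mathrm{link}}(v),y)$ is convex. A solution $w:[0,T)\to\mathbb{R}^N$ of the gradient flow (solutions need not be unique) is regular if $\{t\in[0,T):\sigma_{\mathrm{rp}}'(w(t)_i)=0\text{ for some }i\}$ is finite. It is maximal if for every $\varepsilon>0$ and every solution $\bar w:[0,T+\varepsilon)\to\mathbb{R}^N$ of the same initial value problem $\bar w|_{[0,T)}\ne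 w$. $h:\mathcal{D}_{\mathrm{rp}}\to\mathbb{R}$ is a continuous antiderivative of $h'(\widetilde z):=([\sigma_{\mathrm{rp}}^{-1}]'(\widetilde z))^2$ (which is integrable on compact sets by (A2) and thus has a continuous antiderivative), $H:\mathcal{D}_{\mathrm{rp}}\to\mathbb{R}$ is a continuous antiderivative of $h$, $F(\widetilde z)=\langle\mathbf 1,H(\widetilde z)\rangle=\sum_i H(\widetilde z_i)$, and $D_F(p,q)=F(p)-F(q)-\langle\nabla F(q),p-q\rangle$ is the associated Bregman divergence on $\mathcal{D}_{\mathrm{rp}}^N$ (independent of the choice of antiderivatives), with $D_F(\cdot,\widetilde w_0)$ extended to $\overline{\mathcal{D}_{\mathrm{rp}}^N}$ by continuity, allowing the value $+\infty$. A differentiable function $f:\mathbb{R}^n\to\mathbb{R}$ with minimum $f_\star$ satisfies the Polyak–Lojasiewicz inequality with $\mu>0$ if $\|\nabla f(z)\|_2^2\ge2\mu(f(z)-f_\star)$ for all $z\in\mathbb{R}^n$.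
   Formalization: Part (ii) is false as stated (A=1/2, identity maps, halved squared loss); proved instead: rate e^{-2rκμ(t-t0)} for every κ≥0 with κ‖u‖²≤‖Aᵀu‖² for all u, and rate e^{-2rμ(t-t0)} if the PL inequality with μ is assumed for the function L̃ rather than for v↦L(σ_link(v),y). *)

theory Defs
  imports "HOL-Analysis.Analysis"
begin

section \<open>Vectors and differentiability\<close>

definition entrywise :: "(real \<Rightarrow> real) \<Rightarrow> real ^ 'n \<Rightarrow> real ^ 'n" where
  "entrywise f x = (\<chi> i. f (x $ i))"

definition vecs_in :: "real set \<Rightarrow> (real ^ 'n) set" where
  "vecs_in D = {z. \<forall>i. z $ i \<in> D}"

text \<open>Only meaningful at points where \<open>f\<close> is differentiable.\<close>

definition gradient :: "('a::real_inner \<Rightarrow> real) \<Rightarrow> 'a \<Rightarrow> 'a" where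
  "gradient f x = (THE g. GDERIV f x :> g)"

definition continuously_differentiable :: "('a::real_inner \<Rightarrow> real) \<Rightarrow> bool" where
  "continuously_differentiable f \<longleftrightarrow>
     (\<exists>g. (\<forall>x. GDERIV f x :> g x) \<and> continuous_on UNIV g)"

definition is_minimum :: "('a \<Rightarrow> real) \<Rightarrow> real \<Rightarrow> bool" where
  "is_minimum f m \<longleftrightarrow> (\<exists>x. f x = m) \<and> (\<forall>x. m \<le> f x)"

definition PL_inequality :: "(real ^ 'n \<Rightarrow> real) \<Rightarrow> real \<Rightarrow> bool" where
  "PL_inequality f \<mu> \<longleftrightarrow>
     0 < \<mu> \<and> f differentiable_on UNIV \<and>
     (\<exists>fmin. is_minimum f fmin \<and>
             (\<forall>z. 2 * \<mu> * (f z - fmin) \<le> (norm (gradient f z))\<^sup>2))"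

section \<open>Loss functions\<close>

text \<open>The gradient of \<open>reduced_loss\<close> at \<open>z\<close> is \<open>transpose A *v gradient (output_loss ...) (A *v z)\<close>.
  So a PL inequality with constant \<open>\<mu>\<close> for \<open>output_loss\<close> gives one for \<open>reduced_loss\<close> with constant
  \<open>\<kappa> * \<mu>\<close> whenever \<open>\<kappa>\<close> bounds \<open>\<parallel>transpose A *v u\<parallel>\<^sup>2 / \<parallel>u\<parallel>\<^sup>2\<close> from below. The factor \<open>\<kappa>\<close> cannot be
  dropped: for \<open>A = 1/2\<close>, identity links and the halved squared distance as loss, \<open>output_loss\<close> has
  \<open>\<mu> = 1\<close>, but the loss decays only like \<open>exp (- t / 2)\<close>.\<close>

definition output_loss ::
    "(real \<Rightarrow> real) \<Rightarrow> ((real ^ 'm) \<times> (real ^ 'm) \<Rightarrow> real) \<Rightarrow> real ^ 'm \<Rightarrow> real ^ 'm \<Rightarrow> real" where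
  "output_loss \<sigma>link L y v = L (entrywise \<sigma>link v, y)"

definition reduced_loss ::
    "real ^ 'n ^ 'm \<Rightarrow> (real \<Rightarrow> real) \<Rightarrow> ((real ^ 'm) \<times> (real ^ 'm) \<Rightarrow> real) \<Rightarrow> real ^ 'm
      \<Rightarrow> real ^ 'n \<Rightarrow> real" where
  "reduced_loss A \<sigma>link L y z = L (entrywise \<sigma>link (A *v z), y)"

definition param_loss ::
    "real ^ 'n ^ 'm \<Rightarrow> (real \<Rightarrow> real) \<Rightarrow> (real \<Rightarrow> real) \<Rightarrow> ((real ^ 'm) \<times> (real ^ 'm) \<Rightarrow> real)
      \<Rightarrow> real ^ 'm \<Rightarrow> real ^ 'n \<Rightarrow> real" where
  "param_loss A \<sigma>rp \<sigma>link L y z = L (entrywise \<sigma>link (A *v entrywise \<sigma>rp z), y)"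

section \<open>Gradient flow on \<open>[0, T)\<close> with \<open>T\<close> possibly infinite\<close>

definition time_dom :: "ereal \<Rightarrow> real set" where
  "time_dom T = {t. 0 \<le> t \<and> ereal t < T}"

text \<open>The filter \<open>t \<rightarrow> T\<close> from the left.\<close>

definition end_time :: "ereal \<Rightarrow> real filter" where
  "end_time T = (if T = \<infinity> then at_top else at_left (real_of_ereal T))"

definition gradient_flow_solution ::
    "(real ^ 'n \<Rightarrow> real) \<Rightarrow> real ^ 'n \<Rightarrow> ereal \<Rightarrow> (real \<Rightarrow> real ^ 'n) \<Rightarrow> bool" where
  "gradient_flow_solution f w0 T w \<longleftrightarrow>
     w 0 = w0 \<and>
     (\<forall>t\<in>time_dom T. (w has_vector_derivative - gradient f (w t)) (at t within time_dom T))"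

definition critical_times :: "(real \<Rightarrow> real) \<Rightarrow> ereal \<Rightarrow> (real \<Rightarrow> real ^ 'n) \<Rightarrow> real set" where
  "critical_times \<sigma>rp T w = {t \<in> time_dom T. \<exists>i. deriv \<sigma>rp (w t $ i) = 0}"

definition regular_solution :: "(real \<Rightarrow> real) \<Rightarrow> ereal \<Rightarrow> (real \<Rightarrow> real ^ 'n) \<Rightarrow> bool" where
  "regular_solution \<sigma>rp T w \<longleftrightarrow> finite (critical_times \<sigma>rp T w)"

definition maximal_solution ::
    "(real ^ 'n \<Rightarrow> real) \<Rightarrow> real ^ 'n \<Rightarrow> ereal \<Rightarrow> (real \<Rightarrow> real ^ 'n) \<Rightarrow> bool" where
  "maximal_solution f w0 T w \<longleftrightarrow>
     (\<forall>\<epsilon>::real. \<epsilon> > 0 \<longrightarrow> (\<forall>w'. gradient_flow_solution f w0 (T + ereal \<epsilon>) w' \<longrightarrow>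
        (\<exists>t\<in>time_dom T. w' t \<noteq> w t)))"

definition extendable_solution ::
    "(real ^ 'n \<Rightarrow> real) \<Rightarrow> real ^ 'n \<Rightarrow> ereal \<Rightarrow> (real \<Rightarrow> real ^ 'n) \<Rightarrow> bool" where
  "extendable_solution f w0 T w \<longleftrightarrow>
     (\<exists>\<epsilon>::real. \<epsilon> > 0 \<and> (\<exists>w'. gradient_flow_solution f w0 (T + ereal \<epsilon>) w' \<and>
        (\<forall>t\<in>time_dom T. w' t = w t)))"

section \<open>Local integrability and antiderivatives\<close>

definition L1_loc :: "real set \<Rightarrow> (real \<Rightarrow> real) set" where
  "L1_loc D = {f. \<forall>C. compact C \<and> C \<subseteq> D \<longrightarrow> f absolutely_integrable_on C}"

text \<open>The function \<open>h'\<close>. As \<open>\<sigma>\<close> is a bijection onto the interval \<open>D\<close>, its total inverse \<open>inv \<sigma>\<close>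
  is the inverse on \<open>D\<close>. A continuously differentiable bijection from the line onto an interval has
  an open image, so the unrestricted \<open>deriv\<close> is the derivative on \<open>D\<close>. The values at
  the exceptional points where \<open>inv \<sigma>\<close> is not differentiable are irrelevant.\<close>

definition inv_deriv_sq :: "(real \<Rightarrow> real) \<Rightarrow> real \<Rightarrow> real" where
  "inv_deriv_sq \<sigma> z = (deriv (inv \<sigma>) z)\<^sup>2"

text \<open>An antiderivative of a locally integrable function, defined only almost everywhere, is an
  indefinite integral. Pointwise differentiability almost everywhere would not suffice, because it
  does not determine the function up to a constant.\<close>

definition cont_antiderivative :: "real set \<Rightarrow> (real \<Rightarrow> real) \<Rightarrow> (real \<Rightarrow> real) \<Rightarrow> bool" where
  "cont_antiderivative D f G \<longleftrightarrow>
     continuous_on D G \<and>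
     (\<forall>a\<in>D. \<forall>b\<in>D. a \<le> b \<longrightarrow> (f has_integral (G b - G a)) {a..b})"

definition infinite_ends :: "real set \<Rightarrow> ereal set" where
  "infinite_ends D = {Inf (ereal ` D), Sup (ereal ` D)} \<inter> {-\<infinity>, \<infinity>}"

text \<open>The equation \<open>\<bar>\<integral>\<^sub>z\<^sup>b f(x) dx\<bar> = \<infinity>\<close> for \<open>b = \<plusminus>\<infinity>\<close> is read as an improper integral. The orientation
  of the interval is irrelevant under the absolute value.\<close>

definition divergent_at :: "(real \<Rightarrow> real) \<Rightarrow> real \<Rightarrow> ereal \<Rightarrow> bool" where
  "divergent_at f z b \<longleftrightarrow>
     filterlim (\<lambda>\<beta>. \<bar>integral {min z \<beta>..max z \<beta>} f\<bar>) at_top (if b = \<infinity> then at_top else at_bot)"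

definition divergent_class :: "real set \<Rightarrow> (real \<Rightarrow> real) set" where
  "divergent_class D = {f \<in> L1_loc D. \<forall>z\<in>D. \<forall>b\<in>infinite_ends D. divergent_at f z b}"

section \<open>Bregman divergence\<close>

definition sum_potential :: "(real \<Rightarrow> real) \<Rightarrow> real ^ 'n \<Rightarrow> real" where
  "sum_potential H z = 1 \<bullet> entrywise H z"

definition bregman :: "(real ^ 'n \<Rightarrow> real) \<Rightarrow> real ^ 'n \<Rightarrow> real ^ 'n \<Rightarrow> real" where
  "bregman F p q = F p - F q - gradient F q \<bullet> (p - q)"

text \<open>Extension of \<open>bregman F \<cdot> q\<close> from \<open>S\<close> to its closure by continuity, with value \<open>\<infinity>\<close> allowed.\<close>

definition bregman_ext ::
    "(real ^ 'n) set \<Rightarrow> (real ^ 'n \<Rightarrow> real) \<Rightarrow> real ^ 'n \<Rightarrow> real ^ 'n \<Rightarrow> ereal" where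
  "bregman_ext S F p q =
     (if p \<in> S then ereal (bregman F p q) else Lim (at p within S) (\<lambda>z. ereal (bregman F z q)))"

definition bregman_ball ::
    "(real ^ 'n) set \<Rightarrow> (real ^ 'n \<Rightarrow> real) \<Rightarrow> real ^ 'n \<Rightarrow> real \<Rightarrow> (real ^ 'n) set" where
  "bregman_ball S F x r = {z \<in> S. bregman F x z \<le> r}"

end

theory Submission
  imports Defs "HOL-Complex_Analysis.Great_Picard"
begin

text \<open>In the variable \<open>wt = \<sigma>(w)\<close> the gradient flow becomes \<open>wt' = - \<sigma>'(w)\<^sup>2 \<nabla>Lt(wt)\<close>. Since
  \<open>h' = ((\<sigma>\<^sup>-)')\<^sup>2\<close>, where \<open>\<sigma>\<^sup>-\<close> is the inverse of \<open>\<sigma>\<close>, this is a mirror flow: \<open>h(wt)' = - \<nabla>Lt(wt)\<close> in each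
  coordinate, first off the critical times and then, by continuity, at all times (\<open>mirror_deriv\<close>). For every
  minimizer \<open>x\<close> the Bregman divergence \<open>D\<^sub>F(x, wt)\<close> has the derivative \<open>\<nabla>Lt(wt) \<bullet> (x - wt)\<close>
  (\<open>bregman_deriv\<close>), which is at most \<open>- Lt(wt)\<close> by convexity. Hence \<open>D\<^sub>F(x, wt(t)) + t Lt(wt(t))\<close> decreases
  (\<open>bregman_plus_weighted_loss_le\<close>). This is the general rate, and the decrease of \<open>D\<^sub>F(x, wt)\<close>
  keeps the trajectory in a Bregman ball. The linear rate is Gronwall's argument
  with the Polyak-Lojasiewicz inequality (\<open>exponential_decay\<close>).

  The ends of the domain \<open>D\<close> are controlled by a Cauchy-Schwarz inequality,
  \<open>(\<sigma>\<^sup>-(b) - \<sigma>\<^sup>-(a))\<^sup>2 \<le> (b - a) (h(b) - h(a))\<close> (\<open>inv_increment_sq_le\<close>). As \<open>\<sigma>\<^sup>-\<close> is unbounded at each end, \<open>\<bar>h\<bar>\<close>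
  and with it the Bregman divergence from any point of \<open>D\<close> tends to infinity at a finite end. A bounded
  trajectory, whose divergence from \<open>z0\<close> is bounded as well, therefore has bounded parameters \<open>w\<close>
  (\<open>bounded_w\<close>). This has two consequences. If \<open>T\<close> is finite, then \<open>w\<close> is Lipschitz continuous and has a limit,
  from which Peano's theorem continues the flow, so the extension statement holds through its second
  alternative (\<open>bounded_trajectory_extends\<close>). If \<open>T\<close> is infinite, then \<open>wt\<close> has a
  cluster point inside the domain; it is a minimizer, its divergence from \<open>wt\<close> decreases, and so \<open>wt\<close>
  converges to it (\<open>bounded_trajectory_converges\<close>).

  Bregman balls are bounded if \<open>z h'(z)\<close> has divergent integrals, because the divergence of
  \<open>x\<close> from \<open>q\<close> is the integral of \<open>(s - x) h'(s)\<close> between them, which is comparable with the integral of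
  \<open>s h'(s)\<close> far from \<open>x\<close> (\<open>weighted_integral_le_scalar_bregman\<close>).\<close>

section \<open>Half-open time intervals\<close>

lemma time_dom_downward:
  assumes "t \<in> time_dom T" "0 \<le> s" "s \<le> t"
  shows "s \<in> time_dom T"
  using assms le_less_trans[of "ereal s" "ereal t" T] by (auto simp: time_dom_def)

lemma atLeastAtMost_subset_time_dom:
  assumes "t \<in> time_dom T" "0 \<le> s"
  shows "{s..t} \<subseteq> time_dom T"
  using time_dom_downward[OF assms(1)] assms(2) by auto

lemma zero_in_time_dom: "0 < T \<Longrightarrow> 0 \<in> time_dom T"
  by (simp add: time_dom_def zero_ereal_def)

lemma time_dom_later:
  assumes "t \<in> time_dom T"
  obtains b where "t < b" "b \<in> time_dom T"
  using assms ereal_dense2[of "ereal t" T] by (auto simp: time_dom_def)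

lemma at_within_time_dom:
  assumes "b \<in> time_dom T" "t < b"
  shows "at t within time_dom T = at t within {0..b}"
proof (rule at_within_nhd[of t "{..<b}"])
  show "time_dom T \<inter> {..<b} - {t} = {0..b} \<inter> {..<b} - {t}"
    using time_dom_downward[OF assms(1)] by (auto simp: time_dom_def)
qed (use assms in auto)

lemma at_within_time_dom_interior:
  assumes "t \<in> time_dom T" "0 < t"
  shows "at t within time_dom T = at t"
proof -
  obtain b where "t < b" "b \<in> time_dom T"
    using time_dom_later assms(1) by blast
  then have "at t within time_dom T = at t within {0..b}"
    by (rule at_within_time_dom[rotated])
  also have "\<dots> = at t"
    using \<open>t < b\<close> assms(2) by (simp add: at_within_Icc_at)
  finally show ?thesis .
qed

lemma time_dom_decreasing:
  assumes "a \<le> b" "{a..b} \<subseteq> time_dom T"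
    and der: "\<And>t. t \<in> {a..b} \<Longrightarrow> (f has_real_derivative f' t) (at t within time_dom T)"
    and nonpos: "\<And>t. t \<in> {a..b} \<Longrightarrow> f' t \<le> 0"
  shows "f b \<le> f a"
proof (rule DERIV_nonpos_imp_decreasing_open[OF \<open>a \<le> b\<close>])
  show "\<exists>y. DERIV f x :> y \<and> y \<le> 0" if "a < x" "x < b" for x
  proof -
    have "0 \<le> a" using assms(1,2) by (force simp: time_dom_def)
    then have "at x within time_dom T = at x"
      using that assms(2) by (intro at_within_time_dom_interior) auto
    then show ?thesis using der[of x] nonpos[of x] that by auto
  qed
  show "continuous_on {a..b} f"
    using der assms(2) DERIV_continuous[THEN continuous_within_subset]
    by (metis continuous_on_eq_continuous_within)
qed

text \<open>A regular trajectory passes through finitely many times at which the chain rule for \<open>h\<close> says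
  nothing. By the fundamental theorem of calculus the function is there, too, the integral of
  the continuous right-hand side, so no derivative is lost.\<close>

lemma has_vector_derivative_across_finite_set:
  fixes f :: "real \<Rightarrow> 'a::banach"
  assumes "finite K"
    and contf: "continuous_on (time_dom T) f" and contv: "continuous_on (time_dom T) v"
    and der: "\<And>t. t \<in> time_dom T \<Longrightarrow> t \<notin> K \<Longrightarrow>
                (f has_vector_derivative v t) (at t within time_dom T)"
    and t: "t \<in> time_dom T"
  shows "(f has_vector_derivative v t) (at t within time_dom T)"
proof -
  obtain b where b: "t < b" "b \<in> time_dom T"
    using time_dom_later t by blast
  have sub: "{0..b} \<subseteq> time_dom T"
    using atLeastAtMost_subset_time_dom[OF b(2)] by simp
  have int: "(v has_integral f s - f 0) {0..s}" if "s \<in> {0..b}" for s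
  proof (rule fundamental_theorem_of_calculus_interior_strong[OF \<open>finite K\<close>])
    show "(f has_vector_derivative v x) (at x)" if "x \<in> {0<..<s} - K" for x
    proof -
      have "x \<in> time_dom T" using sub that \<open>s \<in> {0..b}\<close> by auto
      then show ?thesis using der[of x] that at_within_time_dom_interior[of x T] by auto
    qed
    show "continuous_on {0..s} f"
      using contf by (rule continuous_on_subset) (use sub that in auto)
  qed (use that in auto)
  have "((\<lambda>u. f 0 + integral {0..u} v) has_vector_derivative v t) (at t within {0..b})"
    using t b sub contv
    by (auto intro!: derivative_eq_intros integral_has_vector_derivative
             intro: continuous_on_subset simp: time_dom_def)
  then have "(f has_vector_derivative v t) (at t within {0..b})"
  proof (rule has_vector_derivative_transform[rotated 2])
    show "t \<in> {0..b}" using t b by (auto simp: time_dom_def)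
    show "f u = f 0 + integral {0..u} v" if "u \<in> {0..b}" for u
      using integral_unique[OF int[OF that]] by simp
  qed
  then show ?thesis
    using at_within_time_dom[OF b(2,1)] by simp
qed

section \<open>Peano's existence theorem\<close>

text \<open>The iterates of the integral operator with delay \<open>\<delta>\<close>. Since the operator looks back by
  \<open>\<delta>\<close>, every iteration makes the iterate final on a further time interval of length \<open>\<delta>\<close>: after \<open>j\<close>
  steps it solves the delayed equation on \<open>[0, j \<delta>]\<close>.\<close>

primrec delayed_iterate :: "('a \<Rightarrow> 'a::euclidean_space) \<Rightarrow> 'a \<Rightarrow> real \<Rightarrow> nat \<Rightarrow> real \<Rightarrow> 'a" where
  "delayed_iterate f x0 \<delta> 0 t = x0"
| "delayed_iterate f x0 \<delta> (Suc j) t =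
     x0 + integral {0..t} (\<lambda>s. f (delayed_iterate f x0 \<delta> j (s - \<delta>)))"

lemma integral_from_zero_Lipschitz:
  fixes g :: "real \<Rightarrow> 'a::euclidean_space"
  assumes contg: "continuous_on UNIV g" and bound: "\<And>x. norm (g x) \<le> M"
  shows "norm (integral {0..t} g - integral {0..s} g) \<le> M * \<bar>t - s\<bar>"
proof -
  have M: "0 \<le> M" using bound[of 0] norm_ge_zero order_trans by blast
  have integrable: "g integrable_on {a..b}" for a b
    using contg by (auto intro: integrable_continuous_real continuous_on_subset)
  have bnd: "norm (integral {a..b} g) \<le> M * (b - a)" if "a \<le> b" for a b
    using integral_bound[OF that, of g M] contg bound by (auto intro: continuous_on_subset)
  have *: "norm (integral {0..t} g - integral {0..s} g) \<le> M * (t - s)" if "s \<le> t" for s t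
  proof -
    consider "t < 0" | "s < 0" "0 \<le> t" | "0 \<le> s" using that by linarith
    then show ?thesis
    proof cases
      case 1
      then show ?thesis using that M by simp
    next
      case 2
      then show ?thesis using bnd[of 0 t] mult_left_mono[OF _ M, of t "t - s"] by simp
    next
      case 3
      then have "integral {0..t} g - integral {0..s} g = integral {s..t} g"
        using Henstock_Kurzweil_Integration.integral_combine[of 0 s t g] that integrable by (simp add: algebra_simps)
      then show ?thesis using bnd[OF that] by simp
    qed
  qed
  show ?thesis
    using *[of s t] *[of t s] by (cases "s \<le> t") (auto simp: norm_minus_commute)
qed

lemma delayed_iterate_Lipschitz:
  assumes contf: "continuous_on UNIV f" and bound: "\<And>x. norm (f x) \<le> M"
  shows "norm (delayed_iterate f x0 \<delta> j t - delayed_iterate f x0 \<delta> j s) \<le> M * \<bar>t - s\<bar>"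
proof (induction j arbitrary: s t)
  case 0
  then show ?case using bound[of 0] norm_ge_zero[of "f 0"] by (simp del: norm_ge_zero)
next
  case (Suc j)
  have "M-lipschitz_on UNIV (delayed_iterate f x0 \<delta> j)"
    using Suc bound[of 0] norm_ge_zero[of "f 0"]
    by (intro lipschitz_onI) (auto simp: dist_norm simp del: norm_ge_zero)
  then have "continuous_on UNIV (delayed_iterate f x0 \<delta> j)"
    by (rule lipschitz_on_continuous_on)
  then have "continuous_on UNIV (\<lambda>s. f (delayed_iterate f x0 \<delta> j (s - \<delta>)))"
    by (rule continuous_on_compose2[OF contf
          continuous_on_compose2[OF _ _ subset_UNIV, where f = "\<lambda>s. s - \<delta>"]])
       (auto intro!: continuous_intros)
  from integral_from_zero_Lipschitz[OF this, of M t s] show ?case using bound by simp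
qed

lemma delayed_iterate_stabilises:
  assumes "0 < \<delta>" "t \<le> real j * \<delta>"
  shows "delayed_iterate f x0 \<delta> (Suc j) t = delayed_iterate f x0 \<delta> j t"
  using assms(2)
proof (induction j arbitrary: t)
  case 0
  then have "{0..t} \<subseteq> {0}" by auto
  then have "integral {0..t} (\<lambda>s. f x0) = 0"
    by (metis integral_empty integral_singleton subset_singletonD)
  then show ?case by simp
next
  case (Suc j)
  have "delayed_iterate f x0 \<delta> (Suc j) (s - \<delta>) = delayed_iterate f x0 \<delta> j (s - \<delta>)"
    if "s \<in> {0..t}" for s
    using that Suc.prems by (intro Suc.IH) (simp add: algebra_simps)
  then have "integral {0..t} (\<lambda>s. f (delayed_iterate f x0 \<delta> (Suc j) (s - \<delta>))) =
      integral {0..t} (\<lambda>s. f (delayed_iterate f x0 \<delta> j (s - \<delta>)))"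
    by (intro integral_cong) (simp only:)
  then show ?case by (simp only: delayed_iterate.simps)
qed

text \<open>The iterates with \<open>k\<close> steps of length \<open>1 / k\<close> share the Lipschitz constant \<open>M\<close>, so the
  Arzela-Ascoli theorem provides a limit. It solves the equation without delay, because a
  shift in time by \<open>1 / k\<close> moves an iterate by at most \<open>M / k\<close>.\<close>

lemma Peano_bounded:
  fixes f :: "'a::euclidean_space \<Rightarrow> 'a"
  assumes contf: "continuous_on UNIV f" and bound: "\<And>x. norm (f x) \<le> M"
  shows "\<exists>u :: real \<Rightarrow> 'a. continuous_on {0..1} u \<and>
    (\<forall>t\<in>{0..1}. u t = x0 + integral {0..t} (\<lambda>s. f (u s)))"
proof -
  have M: "0 \<le> M" using bound[of 0] norm_ge_zero order_trans by blast
  define \<delta> where "\<delta> k = 1 / real (Suc k)" for k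
  define X where "X k = delayed_iterate f x0 (\<delta> k) (Suc k)" for k
  have \<delta>: "0 < \<delta> k" for k by (simp add: \<delta>_def)
  have lip: "norm (X k t - X k s) \<le> M * \<bar>t - s\<bar>" for k s t
    unfolding X_def by (rule delayed_iterate_Lipschitz[OF contf bound])
  have contX: "continuous_on UNIV (X k)" for k
  proof -
    have "M-lipschitz_on UNIV (X k)"
      using lip M by (intro lipschitz_onI) (auto simp: dist_norm)
    then show ?thesis by (rule lipschitz_on_continuous_on)
  qed
  have X_eq: "X k t = x0 + integral {0..t} (\<lambda>s. f (X k (s - \<delta> k)))" if "t \<le> 1" for k t
  proof -
    have "t \<le> real (Suc k) * \<delta> k" using that by (simp add: \<delta>_def)
    from delayed_iterate_stabilises[OF \<delta> this, of f x0]
    show ?thesis unfolding X_def by (metis delayed_iterate.simps(2))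
  qed
  have X0: "X k 0 = x0" for k using X_eq[of 0 k] by simp
  obtain u r where u: "continuous_on {0..1} u" "strict_mono (r :: nat \<Rightarrow> nat)"
    and conv: "\<And>e. 0 < e \<Longrightarrow> \<exists>N. \<forall>n x. n \<ge> N \<and> x \<in> {0..1} \<longrightarrow> norm (X (r n) x - u x) < e"
  proof (rule Arzela_Ascoli[of "{0..1::real}" X "norm x0 + M"])
    show "norm (X n x) \<le> norm x0 + M" if "x \<in> {0..1}" for n x
    proof -
      have "norm (X n x - x0) \<le> M * 1"
        using lip[of n x 0] X0 that mult_left_mono[OF _ M, of "\<bar>x\<bar>" 1] by simp
      then show ?thesis using norm_triangle_ineq2[of "X n x" x0] by linarith
    qed
    show "\<exists>d. 0 < d \<and> (\<forall>n y. y \<in> {0..1} \<and> norm (x - y) < d \<longrightarrow> norm (X n x - X n y) < e)"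
      if "x \<in> {0..1}" "0 < e" for x e
    proof (intro exI[of _ "e / (M + 1)"] conjI allI impI)
      show "0 < e / (M + 1)" using M that by simp
      fix n y assume "y \<in> {0..1} \<and> norm (x - y) < e / (M + 1)"
      then have "\<bar>x - y\<bar> * (M + 1) < e" using M by (simp add: pos_less_divide_eq)
      then have "M * \<bar>x - y\<bar> < e"
        using abs_ge_zero[of "x - y"] unfolding distrib_left mult_1_right
        by (simp only: mult.commute)
      then show "norm (X n x - X n y) < e" using lip[of n x y] by linarith
    qed
  qed auto
  have \<delta>_lim: "(\<lambda>n. \<delta> (r n)) \<longlonglongrightarrow> 0"
    using LIMSEQ_subseq_LIMSEQ[OF LIMSEQ_inverse_real_of_nat u(2)]
    by (simp add: \<delta>_def o_def inverse_eq_divide)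
  have lim: "(\<lambda>n. X (r n) s) \<longlonglongrightarrow> u s" if "s \<in> {0..1}" for s
    using conv that by (intro LIMSEQ_I) blast
  have lim_delayed: "(\<lambda>n. X (r n) (s - \<delta> (r n))) \<longlonglongrightarrow> u s" if "s \<in> {0..1}" for s
  proof -
    have "(\<lambda>n. X (r n) (s - \<delta> (r n)) - X (r n) s) \<longlonglongrightarrow> 0"
    proof (rule Lim_null_comparison)
      show "\<forall>\<^sub>F n in sequentially. norm (X (r n) (s - \<delta> (r n)) - X (r n) s) \<le> M * \<delta> (r n)"
        using lip[of "r _" "s - \<delta> (r _)" s] \<delta> by (auto simp: less_imp_le abs_of_nonneg)
      show "(\<lambda>n. M * \<delta> (r n)) \<longlonglongrightarrow> 0"
        using tendsto_mult_right_zero[OF \<delta>_lim] .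
    qed
    from tendsto_add[OF this lim[OF that]] show ?thesis by simp
  qed
  have "u t = x0 + integral {0..t} (\<lambda>s. f (u s))" if t: "t \<in> {0..1}" for t
  proof -
    have "(\<lambda>n. integral {0..t} (\<lambda>s. f (X (r n) (s - \<delta> (r n))))) \<longlonglongrightarrow>
        integral {0..t} (\<lambda>s. f (u s))"
    proof (rule dominated_convergence(2)[where h = "\<lambda>_. M"])
      show "(\<lambda>s. f (X (r n) (s - \<delta> (r n)))) integrable_on {0..t}" for n
        by (rule integrable_continuous_real, rule continuous_on_compose2[OF contf
              continuous_on_compose2[OF contX _ subset_UNIV, where f = "\<lambda>s. s - \<delta> (r n)"]])
           (auto intro!: continuous_intros)
      show "(\<lambda>n. f (X (r n) (s - \<delta> (r n)))) \<longlonglongrightarrow> f (u s)" if "s \<in> {0..t}" for s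
      proof (rule isCont_tendsto_compose[OF _ lim_delayed])
        show "isCont f (u s)" using contf by (simp add: continuous_on_eq_continuous_at)
        show "s \<in> {0..1}" using that t by auto
      qed
    qed (use bound in auto)
    then have "(\<lambda>n. x0 + integral {0..t} (\<lambda>s. f (X (r n) (s - \<delta> (r n))))) \<longlonglongrightarrow>
        x0 + integral {0..t} (\<lambda>s. f (u s))"
      by (intro tendsto_intros)
    then have "(\<lambda>n. X (r n) t) \<longlonglongrightarrow> x0 + integral {0..t} (\<lambda>s. f (u s))"
      using X_eq[of t] t by simp
    with lim[OF t] show ?thesis by (rule LIMSEQ_unique)
  qed
  with u(1) show ?thesis by blast
qed

text \<open>The field is made bounded by projecting its argument to the unit ball around \<open>x0\<close>; a
  solution of the modified equation stays in this ball for a short time.\<close>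

theorem Peano_existence:
  fixes f :: "'a::euclidean_space \<Rightarrow> 'a"
  assumes contf: "continuous_on UNIV f"
  obtains \<epsilon> :: real and u :: "real \<Rightarrow> 'a" where "0 < \<epsilon>" "u 0 = x0"
    "\<And>t. t \<in> {0..\<epsilon>} \<Longrightarrow> (u has_vector_derivative f (u t)) (at t within {0..\<epsilon>})"
proof -
  let ?P = "closest_point (cball x0 1)"
  have contP: "continuous_on UNIV ?P"
    by (rule continuous_on_closest_point) auto
  have inP: "?P x \<in> cball x0 1" for x
    by (rule closest_point_in_set) auto
  have "compact (f ` cball x0 1)"
    by (rule compact_continuous_image[OF continuous_on_subset[OF contf]]) auto
  then obtain M where M: "0 < M" "\<And>x. x \<in> cball x0 1 \<Longrightarrow> norm (f x) \<le> M"
    using compact_imp_bounded by (force simp: bounded_pos)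
  have cont: "continuous_on UNIV (\<lambda>x. f (?P x))"
    by (rule continuous_on_compose2[OF contf contP]) auto
  obtain u :: "real \<Rightarrow> 'a" where u: "continuous_on {0..1} u"
    "\<And>t. t \<in> {0..1} \<Longrightarrow> u t = x0 + integral {0..t} (\<lambda>s. f (?P (u s)))"
    using Peano_bounded[OF cont M(2)[OF inP], of x0] by blast
  define \<epsilon> where "\<epsilon> = min 1 (1 / M)"
  have \<epsilon>: "0 < \<epsilon>" "\<epsilon> \<le> 1" "M * \<epsilon> \<le> 1"
    using M(1) by (auto simp: \<epsilon>_def min_def field_simps)
  have cont_fu: "continuous_on {0..1} (\<lambda>s. f (?P (u s)))"
    using continuous_on_compose2[OF cont u(1)] by auto
  have in_ball: "u t \<in> cball x0 1" if "t \<in> {0..\<epsilon>}" for t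
  proof -
    have "norm (integral {0..t} (\<lambda>s. f (?P (u s)))) \<le> M * (t - 0)"
      using that \<epsilon> M(2) inP
      by (intro integral_bound continuous_on_subset[OF cont_fu]) auto
    also have "\<dots> \<le> M * \<epsilon>" using that M(1) by simp
    also have "\<dots> \<le> 1" by (rule \<epsilon>(3))
    finally show ?thesis using u(2)[of t] that \<epsilon> by (simp add: dist_norm)
  qed
  have "(u has_vector_derivative f (u t)) (at t within {0..\<epsilon>})" if t: "t \<in> {0..\<epsilon>}" for t
  proof -
    have "((\<lambda>t. x0 + integral {0..t} (\<lambda>s. f (?P (u s)))) has_vector_derivative f (?P (u t)))
        (at t within {0..\<epsilon>})"
      using t \<epsilon> by (auto intro!: derivative_eq_intros integral_has_vector_derivative
          intro: continuous_on_subset[OF cont_fu])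
    moreover have "?P (u t) = u t" using in_ball[OF t] by (rule closest_point_self)
    ultimately show ?thesis
      using t \<epsilon> u(2)
      by (intro has_vector_derivative_transform[where g = u and
            f = "\<lambda>t. x0 + integral {0..t} (\<lambda>s. f (?P (u s)))"]) auto
  qed
  moreover have "u 0 = x0" using u(2)[of 0] by simp
  ultimately show ?thesis using \<epsilon>(1) that by blast
qed

section \<open>Bregman divergences on the line\<close>

definition scalar_bregman :: "(real \<Rightarrow> real) \<Rightarrow> (real \<Rightarrow> real) \<Rightarrow> real \<Rightarrow> real \<Rightarrow> real" where
  "scalar_bregman h H x q = H x - H q - h q * (x - q)"

text \<open>The three-point identity of Bregman divergences.\<close>

lemma scalar_bregman_three_points:
  "scalar_bregman h H x q2 - scalar_bregman h H x q1 =
     (q1 - x) * (h q2 - h q1) + scalar_bregman h H q1 q2"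
  by (simp add: scalar_bregman_def algebra_simps)

locale convex_potential =
  fixes D :: "real set" and h H :: "real \<Rightarrow> real"
  assumes interval: "is_interval D"
    and h_strict_mono: "\<And>a b. a \<in> D \<Longrightarrow> b \<in> D \<Longrightarrow> a < b \<Longrightarrow> h a < h b"
    and H_deriv: "\<And>z. z \<in> D \<Longrightarrow> (H has_real_derivative h z) (at z)"
begin

lemma h_mono: "a \<in> D \<Longrightarrow> b \<in> D \<Longrightarrow> a \<le> b \<Longrightarrow> h a \<le> h b"
  using h_strict_mono[of a b] by (cases "a = b") auto

lemma Icc_subset: "a \<in> D \<Longrightarrow> b \<in> D \<Longrightarrow> {a..b} \<subseteq> D"
  using mem_is_interval_1_I[OF interval, of a b] by auto

lemma scalar_bregman_pos:
  assumes "x \<in> D" "q \<in> D" "x \<noteq> q"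
  shows "0 < scalar_bregman h H x q"
proof (cases "q < x")
  case True
  obtain \<xi> where \<xi>: "q < \<xi>" "\<xi> < x" "H x - H q = (x - q) * h \<xi>"
    using MVT2[OF True, of H h, OF H_deriv] Icc_subset[OF assms(2,1)] by fastforce
  then have "h q < h \<xi>"
    using Icc_subset[OF assms(2,1)] assms by (intro h_strict_mono) auto
  then have "0 < (x - q) * (h \<xi> - h q)" using True by simp
  then show ?thesis using \<xi>(3) by (simp add: scalar_bregman_def algebra_simps)
next
  case False
  then have less: "x < q" using assms by simp
  obtain \<xi> where \<xi>: "x < \<xi>" "\<xi> < q" "H q - H x = (q - x) * h \<xi>"
    using MVT2[OF less, of H h, OF H_deriv] Icc_subset[OF assms(1,2)] by fastforce
  then have "h \<xi> < h q"
    using Icc_subset[OF assms(1,2)] assms by (intro h_strict_mono) auto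
  then have "0 < (q - x) * (h q - h \<xi>)" using less by simp
  then show ?thesis using \<xi>(3) by (simp add: scalar_bregman_def algebra_simps)
qed

lemma scalar_bregman_nonneg:
  "x \<in> D \<Longrightarrow> q \<in> D \<Longrightarrow> 0 \<le> scalar_bregman h H x q"
  using scalar_bregman_pos[of x q] by (cases "x = q") (auto simp: scalar_bregman_def)

text \<open>The divergence controls the growth of \<open>h\<close> towards either end: this is the three-point identity
  without the nonnegative term.\<close>

lemma h_growth_le_scalar_bregman:
  "q1 \<in> D \<Longrightarrow> q2 \<in> D \<Longrightarrow>
     (q1 - x) * (h q2 - h q1) \<le> scalar_bregman h H x q2 - scalar_bregman h H x q1"
  using scalar_bregman_nonneg[of q1 q2] by (simp add: scalar_bregman_three_points)

text \<open>The divergence is the integral of \<open>(s - x) h'(s)\<close> over \<open>[x, q]\<close>. Instead of integrating by parts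
  with a derivative that exists only almost everywhere, the growth estimate is summed over dyadic
  intervals. The factor \<open>4\<close> is due to \<open>s \<le> 2 a \<le> 4 (a - x)\<close> for \<open>s\<close> in \<open>[a, 2 a]\<close>, where \<open>a\<close> is positive
  and \<open>a \<ge> 2 x\<close>.\<close>

lemma weighted_integral_le_scalar_bregman:
  assumes k_nonneg: "\<And>z. 0 \<le> k z"
    and k: "\<And>a b. a \<in> D \<Longrightarrow> b \<in> D \<Longrightarrow> a \<le> b \<Longrightarrow> (k has_integral h b - h a) {a..b}"
    and integrable: "\<And>a b. a \<in> D \<Longrightarrow> b \<in> D \<Longrightarrow> (\<lambda>z. z * k z) integrable_on {a..b}"
    and c: "0 < c" "2 * x \<le> c" "{c..} \<subseteq> D" and "c \<le> q"
  shows "integral {c..q} (\<lambda>z. z * k z) \<le> 4 * (scalar_bregman h H x q - scalar_bregman h H x c)"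
proof -
  have dyadic: "integral {c..q} (\<lambda>z. z * k z) \<le>
      4 * (scalar_bregman h H x q - scalar_bregman h H x c)"
    if "c \<le> q" "q \<le> 2 ^ n * c" for n q
    using that
  proof (induction n arbitrary: q)
    case 0
    then show ?case by simp
  next
    case (Suc n)
    show ?case
    proof (cases "q \<le> 2 ^ n * c")
      case True
      then show ?thesis using Suc by blast
    next
      case False
      define a where "a = 2 ^ n * c"
      have a: "c \<le> a" "a \<le> q" "q \<le> 2 * a"
        using False Suc.prems c(1) by (auto simp: a_def)
      have in_D: "c \<in> D" "a \<in> D" "q \<in> D" using a c(3) by auto
      have "integral {a..q} (\<lambda>z. z * k z) \<le> q * (h q - h a)"
      proof (rule has_integral_le)
        show "((\<lambda>z. q * k z) has_integral q * (h q - h a)) {a..q}"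
          using k[of a q] in_D a by (intro has_integral_mult_right) auto
        show "z * k z \<le> q * k z" if "z \<in> {a..q}" for z
          using that k_nonneg by (intro mult_right_mono) auto
      qed (use integrable in_D in \<open>auto simp: has_integral_integral\<close>)
      also have "\<dots> \<le> (4 * (a - x)) * (h q - h a)"
        using h_mono[of a q] in_D a c by (intro mult_right_mono) auto
      also have "\<dots> \<le> 4 * (scalar_bregman h H x q - scalar_bregman h H x a)"
        using mult_left_mono[OF h_growth_le_scalar_bregman[of a q x], of 4] in_D
        by (simp only: mult.assoc)
      finally have "integral {a..q} (\<lambda>z. z * k z) \<le>
          4 * (scalar_bregman h H x q - scalar_bregman h H x a)" .
      moreover have "integral {c..a} (\<lambda>z. z * k z) \<le>
          4 * (scalar_bregman h H x a - scalar_bregman h H x c)"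
        using Suc.IH[of a] a by (simp add: a_def)
      moreover have "integral {c..a} (\<lambda>z. z * k z) + integral {a..q} (\<lambda>z. z * k z) =
          integral {c..q} (\<lambda>z. z * k z)"
        using a integrable in_D by (intro Henstock_Kurzweil_Integration.integral_combine) auto
      ultimately show ?thesis by simp
    qed
  qed
  obtain n where "q / c < 2 ^ n" using real_arch_pow[of 2 "q / c"] by auto
  then have "q \<le> 2 ^ n * c" using c(1) by (simp add: field_simps)
  with \<open>c \<le> q\<close> show ?thesis by (rule dyadic)
qed

text \<open>Up to a constant, the divergence from \<open>x\<close> is at least a quarter of an integral that tends to
  infinity at an infinite upper end.\<close>

lemma scalar_bregman_sublevel_bdd_above:
  assumes k_nonneg: "\<And>z. 0 \<le> k z"
    and k: "\<And>a b. a \<in> D \<Longrightarrow> b \<in> D \<Longrightarrow> a \<le> b \<Longrightarrow> (k has_integral h b - h a) {a..b}"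
    and integrable: "\<And>a b. a \<in> D \<Longrightarrow> b \<in> D \<Longrightarrow> (\<lambda>z. z * k z) integrable_on {a..b}"
    and diverges: "\<And>z. \<not> bdd_above D \<Longrightarrow> z \<in> D \<Longrightarrow>
        filterlim (\<lambda>\<beta>. \<bar>integral {z..\<beta>} (\<lambda>z. z * k z)\<bar>) at_top at_top"
    and x: "x \<in> D"
  shows "\<exists>B. \<forall>q\<in>D. scalar_bregman h H x q \<le> r \<longrightarrow> q \<le> B"
proof (cases "bdd_above D")
  case True
  then show ?thesis by (auto simp: bdd_above_def)
next
  case False
  have right: "{x..} \<subseteq> D"
  proof
    fix q assume "q \<in> {x..}"
    obtain b where "b \<in> D" "q \<le> b"
      using False by (meson bdd_above.I linear)
    then show "q \<in> D" using Icc_subset[OF x, of b] \<open>q \<in> {x..}\<close> by auto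
  qed
  define c where "c = 2 * \<bar>x\<bar> + 1"
  have c: "0 < c" "2 * x \<le> c" "{c..} \<subseteq> D" using right by (auto simp: c_def)
  have "\<forall>\<^sub>F q in at_top. 4 * r < \<bar>integral {c..q} (\<lambda>z. z * k z)\<bar>"
    using diverges[OF False, of c] c(3) by (auto simp: filterlim_at_top_dense)
  then obtain B where B: "\<And>q. B \<le> q \<Longrightarrow> 4 * r < \<bar>integral {c..q} (\<lambda>z. z * k z)\<bar>"
    by (auto simp: eventually_at_top_linorder)
  have "q \<le> max B c" if "q \<in> D" "scalar_bregman h H x q \<le> r" for q
  proof (rule ccontr)
    assume "\<not> q \<le> max B c"
    then have q: "B \<le> q" "c \<le> q" by auto
    have "0 \<le> integral {c..q} (\<lambda>z. z * k z)"
      using k_nonneg c integrable[of c q] that(1) by (intro integral_nonneg) auto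
    then have "4 * r < 4 * (scalar_bregman h H x q - scalar_bregman h H x c)"
      using B[OF q(1)] weighted_integral_le_scalar_bregman[OF k_nonneg k integrable c q(2)] by simp
    then show False
      using scalar_bregman_nonneg[of x c] x c(3) that(2) by auto
  qed
  then show ?thesis by blast
qed

end

lemma convex_potential_reflect:
  assumes "convex_potential D h H"
  shows "convex_potential (uminus ` D) (\<lambda>z. - h (- z)) (\<lambda>z. H (- z))"
proof -
  interpret convex_potential D h H by fact
  show ?thesis
  proof
    show "is_interval (uminus ` D)"
      using interval by (simp add: is_interval_neg_translationI)
    show "((\<lambda>z. H (- z)) has_real_derivative - h (- z)) (at z)" if "z \<in> uminus ` D" for z
    proof -
      have "- z \<in> D" using that by auto
      from DERIV_chain2[OF H_deriv[OF this] DERIV_minus[OF DERIV_ident]] show ?thesis by simp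
    qed
  qed (use h_strict_mono in auto)
qed

text \<open>The lower end is the upper end of the reflected potential.\<close>

lemma (in convex_potential) scalar_bregman_sublevel_bounded:
  assumes k_nonneg: "\<And>z. 0 \<le> k z"
    and k: "\<And>a b. a \<in> D \<Longrightarrow> b \<in> D \<Longrightarrow> a \<le> b \<Longrightarrow> (k has_integral h b - h a) {a..b}"
    and integrable: "\<And>a b. a \<in> D \<Longrightarrow> b \<in> D \<Longrightarrow> (\<lambda>z. z * k z) integrable_on {a..b}"
    and diverges_above: "\<And>z. \<not> bdd_above D \<Longrightarrow> z \<in> D \<Longrightarrow>
        filterlim (\<lambda>\<beta>. \<bar>integral {z..\<beta>} (\<lambda>z. z * k z)\<bar>) at_top at_top"
    and diverges_below: "\<And>z. \<not> bdd_below D \<Longrightarrow> z \<in> D \<Longrightarrow>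
        filterlim (\<lambda>\<beta>. \<bar>integral {\<beta>..z} (\<lambda>z. z * k z)\<bar>) at_top at_bot"
    and x: "x \<in> D"
  shows "bounded {q \<in> D. scalar_bregman h H x q \<le> r}"
proof -
  interpret reflected: convex_potential "uminus ` D" "\<lambda>z. - h (- z)" "\<lambda>z. H (- z)"
    by (rule convex_potential_reflect) unfold_locales
  obtain B where B: "\<And>q. q \<in> D \<Longrightarrow> scalar_bregman h H x q \<le> r \<Longrightarrow> q \<le> B"
    using scalar_bregman_sublevel_bdd_above[OF k_nonneg k integrable diverges_above x] by blast
  have "\<exists>B. \<forall>q\<in>uminus ` D. scalar_bregman (\<lambda>z. - h (- z)) (\<lambda>z. H (- z)) (- x) q \<le> r \<longrightarrow> q \<le> B"
  proof (rule reflected.scalar_bregman_sublevel_bdd_above[where k = "\<lambda>z. k (- z)"])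
    show "((\<lambda>z. k (- z)) has_integral - h (- b) - - h (- a)) {a..b}"
      if "a \<in> uminus ` D" "b \<in> uminus ` D" "a \<le> b" for a b
    proof -
      have "(k has_integral h (- a) - h (- b)) {- b..- a}"
        by (rule k) (use that in auto)
      from has_integral_reflect_real[THEN iffD2, OF this] show ?thesis by simp
    qed
    show "(\<lambda>z. z * k (- z)) integrable_on {a..b}"
      if "a \<in> uminus ` D" "b \<in> uminus ` D" for a b
    proof -
      have "(\<lambda>z. z * k z) integrable_on {- b..- a}"
        by (rule integrable) (use that in auto)
      from integrable_neg[OF Henstock_Kurzweil_Integration.integrable_reflect_real[THEN iffD2, OF this]] show ?thesis by simp
    qed
    show "filterlim (\<lambda>\<beta>. \<bar>integral {z..\<beta>} (\<lambda>z. z * k (- z))\<bar>) at_top at_top"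
      if "\<not> bdd_above (uminus ` D)" "z \<in> uminus ` D" for z
    proof -
      have "filterlim (\<lambda>\<beta>. \<bar>integral {- \<beta>..- z} (\<lambda>z. z * k z)\<bar>) at_top at_top"
        using filterlim_compose[OF diverges_below[of "- z"] filterlim_uminus_at_bot_at_top] that
        by (auto simp: bdd_above_uminus)
      moreover have "\<bar>integral {- \<beta>..- z} (\<lambda>z. z * k z)\<bar> = \<bar>integral {z..\<beta>} (\<lambda>z. z * k (- z))\<bar>" for \<beta>
        using Henstock_Kurzweil_Integration.integral_reflect_real[of "- z" "- \<beta>" "\<lambda>z. z * k z"] by simp
      ultimately show ?thesis by simp
    qed
  qed (use k_nonneg x in auto)
  then obtain B' where "\<And>q. q \<in> D \<Longrightarrow>
      scalar_bregman (\<lambda>z. - h (- z)) (\<lambda>z. H (- z)) (- x) (- q) \<le> r \<Longrightarrow> - q \<le> B'"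
    by blast
  moreover have "scalar_bregman (\<lambda>z. - h (- z)) (\<lambda>z. H (- z)) (- x) (- q) = scalar_bregman h H x q" for q
    by (simp add: scalar_bregman_def algebra_simps)
  ultimately have B': "\<And>q. q \<in> D \<Longrightarrow> scalar_bregman h H x q \<le> r \<Longrightarrow> - q \<le> B'"
    by simp
  show ?thesis
    unfolding bounded_real
    using B B' by (intro exI[of _ "max B B'"])
      (auto simp: abs_le_iff intro: max.coboundedI1 max.coboundedI2)
qed

section \<open>The reparametrization and its potential\<close>

lemma AE_lebesgue_imp_negligible:
  assumes "AE x in lebesgue. P x" and "\<And>x. x \<in> S \<Longrightarrow> \<not> P x"
  shows "negligible S"
proof -
  obtain N where "N \<in> null_sets lebesgue" "{x \<in> space lebesgue. \<not> P x} \<subseteq> N"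
    using assms(1) by (auto simp: eventually_ae_filter)
  then show ?thesis
    using assms(2) by (intro negligible_subset[of N S]) (auto simp: negligible_iff_null_sets)
qed

lemma C1_differentiable_on_UNIV_deriv:
  fixes f :: "real \<Rightarrow> real"
  assumes "f C1_differentiable_on UNIV"
  shows "(f has_real_derivative deriv f x) (at x)" and "continuous_on UNIV (deriv f)"
proof -
  obtain f' where f': "\<And>x. (f has_vector_derivative f' x) (at x)" "continuous_on UNIV f'"
    using assms by (auto simp: C1_differentiable_on_def)
  then have "deriv f = f'"
    by (auto simp: fun_eq_iff has_real_derivative_iff_has_vector_derivative intro!: DERIV_imp_deriv)
  then show "(f has_real_derivative deriv f x) (at x)" "continuous_on UNIV (deriv f)"
    using f' by (auto simp: has_real_derivative_iff_has_vector_derivative)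
qed

locale reparametrization =
  fixes \<sigma> :: "real \<Rightarrow> real" and D :: "real set" and h H :: "real \<Rightarrow> real"
  assumes D_interval: "is_interval D"
    and bij: "bij_betw \<sigma> UNIV D"
    and C1: "\<sigma> C1_differentiable_on UNIV"
    and deriv_nonzero_AE: "AE x in lebesgue. deriv \<sigma> x \<noteq> 0"
    and inv_differentiable_AE: "AE z in lebesgue. z \<in> D \<longrightarrow> inv \<sigma> differentiable (at z)"
    and h_antiderivative: "cont_antiderivative D (inv_deriv_sq \<sigma>) h"
    and H_antiderivative: "\<And>z. z \<in> D \<Longrightarrow> (H has_real_derivative h z) (at z within D)"
begin

lemmas \<sigma>_deriv = C1_differentiable_on_UNIV_deriv(1)[OF C1]
lemmas continuous_deriv_\<sigma> = C1_differentiable_on_UNIV_deriv(2)[OF C1]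

lemma continuous_\<sigma>: "continuous_on UNIV \<sigma>"
  using \<sigma>_deriv DERIV_isCont by (auto simp: continuous_on_eq_continuous_at)

lemma inj_\<sigma>: "inj \<sigma>"
  using bij by (rule bij_betw_imp_inj_on)

lemma range_\<sigma>: "range \<sigma> = D"
  using bij by (rule bij_betw_imp_surj_on)

lemma \<sigma>_in_D [simp]: "\<sigma> x \<in> D"
  using range_\<sigma> by auto

lemma inv_\<sigma> [simp]: "inv \<sigma> (\<sigma> x) = x"
  using inj_\<sigma> by simp

lemma \<sigma>_inv [simp]: "z \<in> D \<Longrightarrow> \<sigma> (inv \<sigma> z) = z"
  using range_\<sigma> by (simp add: f_inv_into_f)

lemma open_D: "open D"
  using invariance_of_domain[OF continuous_\<sigma> open_UNIV inj_\<sigma>] range_\<sigma> by simp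

lemma continuous_inv: "continuous_on D (inv \<sigma>)"
  using continuous_on_inverse_open[OF open_UNIV continuous_\<sigma>, of "inv \<sigma>"] range_\<sigma> by simp

lemma inv_deriv:
  assumes "deriv \<sigma> x \<noteq> 0"
  shows "(inv \<sigma> has_real_derivative 1 / deriv \<sigma> x) (at (\<sigma> x))"
  unfolding has_field_derivative_def
proof (rule has_derivative_inverse_strong[OF open_UNIV _ continuous_\<sigma>])
  show "(\<sigma> has_derivative (*) (deriv \<sigma> x)) (at x)"
    using \<sigma>_deriv by (simp add: has_field_derivative_def)
qed (use assms in \<open>auto simp: fun_eq_iff\<close>)

lemma inv_deriv_sq_eq: "deriv \<sigma> x \<noteq> 0 \<Longrightarrow> inv_deriv_sq \<sigma> (\<sigma> x) = 1 / (deriv \<sigma> x)\<^sup>2"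
  by (simp add: inv_deriv_sq_def DERIV_imp_deriv[OF inv_deriv] power_divide)

text \<open>At critical values the chain rule for \<open>inv \<sigma> \<circ> \<sigma>\<close> would give \<open>1 = 0\<close>. Therefore almost everywhere
  differentiability of \<open>inv \<sigma>\<close> makes the set of critical values null.\<close>

lemma inv_not_differentiable:
  assumes "deriv \<sigma> x = 0"
  shows "\<not> inv \<sigma> differentiable (at (\<sigma> x))"
proof
  assume "inv \<sigma> differentiable (at (\<sigma> x))"
  then obtain d where "(inv \<sigma> has_real_derivative d) (at (\<sigma> x))"
    by (auto simp: real_differentiable_def)
  from DERIV_chain2[OF this \<sigma>_deriv] have "((\<lambda>x. x) has_real_derivative 0) (at x)"
    using assms by simp
  then show False using DERIV_unique[OF DERIV_ident] by fastforce
qed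

lemma negligible_critical_points: "negligible {x. deriv \<sigma> x = 0}"
  using deriv_nonzero_AE by (rule AE_lebesgue_imp_negligible) simp

lemma negligible_critical_values: "negligible (\<sigma> ` {x. deriv \<sigma> x = 0})"
  using inv_differentiable_AE by (rule AE_lebesgue_imp_negligible) (auto simp: inv_not_differentiable)

lemma h_integral:
  "a \<in> D \<Longrightarrow> b \<in> D \<Longrightarrow> a \<le> b \<Longrightarrow> (inv_deriv_sq \<sigma> has_integral h b - h a) {a..b}"
  using h_antiderivative by (auto simp: cont_antiderivative_def)

lemma continuous_h: "continuous_on D h"
  using h_antiderivative by (auto simp: cont_antiderivative_def)

lemma D_Icc: "a \<in> D \<Longrightarrow> b \<in> D \<Longrightarrow> {a..b} \<subseteq> D"
  using mem_is_interval_1_I[OF D_interval, of a b] by auto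

text \<open>The inverse recovers from its derivative although that exists only almost everywhere: the
  exceptional sets are null on both sides, so the change of variables formula applies off them.\<close>

lemma abs_inv_deriv_integral:
  assumes "a \<in> D" "b \<in> D" "a \<le> b"
  shows "((\<lambda>z. \<bar>deriv (inv \<sigma>) z\<bar>) has_integral \<bar>inv \<sigma> b - inv \<sigma> a\<bar>) {a..b}"
proof -
  define Z where "Z = {x. deriv \<sigma> x = 0}"
  define S where "S = {a..b} - \<sigma> ` Z"
  have neg: "negligible Z" "negligible (\<sigma> ` Z)"
    unfolding Z_def by (fact negligible_critical_points negligible_critical_values)+
  have sub: "{a..b} \<subseteq> D" using D_Icc assms by blast
  have inj: "inj_on (inv \<sigma>) D" by (metis \<sigma>_inv inj_onI)
  have "inv \<sigma> ` closed_segment a b = closed_segment (inv \<sigma> a) (inv \<sigma> b)"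
    using sub assms(3)
    by (intro continuous_injective_image_segment_1)
       (auto simp: closed_segment_eq_real_ivl intro: continuous_on_subset[OF continuous_inv] inj_on_subset[OF inj])
  then have segment: "inv \<sigma> ` {a..b} = closed_segment (inv \<sigma> a) (inv \<sigma> b)"
    using assms(3) by (simp add: closed_segment_eq_real_ivl)
  have image: "inv \<sigma> ` S = closed_segment (inv \<sigma> a) (inv \<sigma> b) - Z"
    using sub unfolding segment[symmetric] S_def by (auto simp: image_iff) (metis \<sigma>_inv subsetD atLeastAtMost_iff)
  have "((\<lambda>_. 1) has_integral \<bar>inv \<sigma> b - inv \<sigma> a\<bar>) (closed_segment (inv \<sigma> a) (inv \<sigma> b))"
    using has_integral_const_real[of "1::real" "inv \<sigma> a" "inv \<sigma> b"]
      has_integral_const_real[of "1::real" "inv \<sigma> b" "inv \<sigma> a"]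
    by (simp add: closed_segment_eq_real_ivl abs_if split: if_splits)
  moreover have "((\<lambda>_. 1) has_integral \<bar>inv \<sigma> b - inv \<sigma> a\<bar>) (inv \<sigma> ` S) \<longleftrightarrow>
      ((\<lambda>_. 1) has_integral \<bar>inv \<sigma> b - inv \<sigma> a\<bar>) (closed_segment (inv \<sigma> a) (inv \<sigma> b))"
    unfolding image
    by (rule has_integral_spike_set_eq) (auto intro: negligible_subset[OF neg(1)])
  ultimately have int1: "((\<lambda>_. 1::real) has_integral \<bar>inv \<sigma> b - inv \<sigma> a\<bar>) (inv \<sigma> ` S)"
    by simp
  have "(\<lambda>_. 1::real) absolutely_integrable_on (inv \<sigma> ` S)"
    using int1 by (intro nonnegative_absolutely_integrable_1) (auto simp: integrable_on_def)
  moreover have "integral (inv \<sigma> ` S) (\<lambda>_. 1::real) = \<bar>inv \<sigma> b - inv \<sigma> a\<bar>"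
    using int1 by (rule integral_unique)
  moreover have "S \<in> sets lebesgue"
    using negligible_imp_sets[OF neg(2)] by (auto simp: S_def)
  moreover have "(inv \<sigma> has_field_derivative deriv (inv \<sigma>) z) (at z within S)" if "z \<in> S" for z
  proof -
    have "deriv \<sigma> (inv \<sigma> z) \<noteq> 0" "z \<in> D"
      using that sub by (auto simp: S_def Z_def image_iff) (metis \<sigma>_inv atLeastAtMost_iff subsetD)
    then show ?thesis
      using inv_deriv[of "inv \<sigma> z"] DERIV_imp_deriv[OF inv_deriv[of "inv \<sigma> z"]]
      by (auto intro: has_field_derivative_at_within)
  qed
  moreover have "inj_on (inv \<sigma>) S"
    using sub by (intro inj_on_subset[OF inj]) (auto simp: S_def)
  ultimately have "(\<lambda>z. \<bar>deriv (inv \<sigma>) z\<bar>) absolutely_integrable_on S \<and>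
      integral S (\<lambda>z. \<bar>deriv (inv \<sigma>) z\<bar>) = \<bar>inv \<sigma> b - inv \<sigma> a\<bar>"
    using has_absolute_integral_change_of_variables_1'[of S "inv \<sigma>" "deriv (inv \<sigma>)" "\<lambda>_. 1"]
    by simp
  then have "((\<lambda>z. \<bar>deriv (inv \<sigma>) z\<bar>) has_integral \<bar>inv \<sigma> b - inv \<sigma> a\<bar>) S"
    using set_lebesgue_integral_eq_integral(1) by (metis has_integral_integral)
  then show ?thesis
    by (rule has_integral_spike_set_eq[THEN iffD1, rotated 2])
       (auto simp: S_def intro: negligible_subset[OF neg(2)])
qed

text \<open>The Cauchy-Schwarz inequality for \<open>inv \<sigma> b - inv \<sigma> a = \<integral> (inv \<sigma>)'\<close>, as
  \<open>h b - h a = \<integral> ((inv \<sigma>)')\<^sup>2\<close>. It makes \<open>h\<close> strictly increasing, and it makes \<open>h\<close> blow up at every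
  finite end of \<open>D\<close>, because \<open>inv \<sigma>\<close> does.\<close>

lemma inv_increment_sq_le:
  assumes "a \<in> D" "b \<in> D" "a \<le> b"
  shows "(inv \<sigma> b - inv \<sigma> a)\<^sup>2 \<le> (b - a) * (h b - h a)"
proof (cases "a = b")
  case False
  \<comment> \<open>The value of \<open>l\<close> for which \<open>2 l v \<le> l\<^sup>2 + v\<^sup>2\<close>, integrated with \<open>v = \<bar>(inv \<sigma>)'\<bar>\<close>, is sharpest.\<close>
  define l where "l = \<bar>inv \<sigma> b - inv \<sigma> a\<bar> / (b - a)"
  have ba: "0 < b - a" using False assms(3) by simp
  have "2 * l * \<bar>inv \<sigma> b - inv \<sigma> a\<bar> \<le> l\<^sup>2 * (b - a) + (h b - h a)"
  proof (rule has_integral_le)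
    show "((\<lambda>z. 2 * l * \<bar>deriv (inv \<sigma>) z\<bar>) has_integral 2 * l * \<bar>inv \<sigma> b - inv \<sigma> a\<bar>) {a..b}"
      by (intro has_integral_mult_right abs_inv_deriv_integral assms)
    show "((\<lambda>z. l\<^sup>2 + inv_deriv_sq \<sigma> z) has_integral l\<^sup>2 * (b - a) + (h b - h a)) {a..b}"
      using has_integral_const_real[of "l\<^sup>2" a b] assms(3)
      by (intro has_integral_add h_integral assms) (auto simp: mult.commute)
    show "2 * l * \<bar>deriv (inv \<sigma>) z\<bar> \<le> l\<^sup>2 + inv_deriv_sq \<sigma> z" for z
      using sum_squares_bound[of l "\<bar>deriv (inv \<sigma>) z\<bar>"] by (simp add: inv_deriv_sq_def)
  qed
  moreover have "l * (b - a) = \<bar>inv \<sigma> b - inv \<sigma> a\<bar>" using ba by (simp add: l_def)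
  ultimately have "l\<^sup>2 * (b - a) \<le> h b - h a"
    by (simp add: power2_eq_square mult.assoc)
  then have "l\<^sup>2 * (b - a) * (b - a) \<le> (h b - h a) * (b - a)"
    using ba by (intro mult_right_mono) auto
  moreover have "l\<^sup>2 * (b - a) * (b - a) = (inv \<sigma> b - inv \<sigma> a)\<^sup>2"
    using \<open>l * (b - a) = _\<close> by (metis mult.assoc power2_abs power2_eq_square power_mult_distrib)
  ultimately show ?thesis by (simp add: mult.commute)
qed simp

sublocale convex_potential D h H
proof
  show "is_interval D" by (fact D_interval)
  show "(H has_real_derivative h z) (at z)" if "z \<in> D" for z
    using H_antiderivative[OF that] at_within_open[OF that open_D] by simp
  show "h a < h b" if "a \<in> D" "b \<in> D" "a < b" for a b
  proof -
    have "inv \<sigma> b - inv \<sigma> a \<noteq> 0" using that \<sigma>_inv by (metis less_irrefl right_minus_eq)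
    then have "0 < (b - a) * (h b - h a)"
      using inv_increment_sq_le[of a b] that by (smt (verit) zero_less_power2)
    then show ?thesis using that by (simp add: zero_less_mult_iff)
  qed
qed

text \<open>Off the critical values \<open>(inv \<sigma>)'\<close> is continuous, so there the almost-everywhere
  antiderivative \<open>h\<close> is a classical one.\<close>

lemma h_deriv:
  assumes "deriv \<sigma> x \<noteq> 0"
  shows "(h has_real_derivative 1 / (deriv \<sigma> x)\<^sup>2) (at (\<sigma> x))"
proof -
  define U where "U = D \<inter> (\<lambda>z. deriv \<sigma> (inv \<sigma> z)) -` (- {0})"
  have cont: "continuous_on D (\<lambda>z. deriv \<sigma> (inv \<sigma> z))"
    by (rule continuous_on_compose2[OF continuous_deriv_\<sigma> continuous_inv]) simp
  have "open U"
    unfolding U_def using cont open_D by (rule continuous_open_preimage) auto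
  moreover have "\<sigma> x \<in> U" using assms by (simp add: U_def)
  ultimately obtain e where e: "0 < e" "cball (\<sigma> x) e \<subseteq> U"
    by (auto simp: open_contains_cball)
  define a b where "a = \<sigma> x - e" and "b = \<sigma> x + e"
  have ab: "{a..b} \<subseteq> U" using e by (auto simp: a_def b_def cball_def dist_real_def subset_iff)
  have aD: "{a..b} \<subseteq> D" using ab by (auto simp: U_def)
  have "continuous_on {a..b} (\<lambda>z. 1 / (deriv \<sigma> (inv \<sigma> z))\<^sup>2)"
    using ab by (intro continuous_intros continuous_on_subset[OF cont]) (auto simp: U_def)
  moreover have "inv_deriv_sq \<sigma> z = 1 / (deriv \<sigma> (inv \<sigma> z))\<^sup>2" if "z \<in> {a..b}" for z
  proof -
    have "deriv \<sigma> (inv \<sigma> z) \<noteq> 0" "z \<in> D" using ab that by (auto simp: U_def)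
    then show ?thesis using inv_deriv_sq_eq[of "inv \<sigma> z"] by simp
  qed
  ultimately have "continuous_on {a..b} (inv_deriv_sq \<sigma>)"
    by (metis (no_types, lifting) continuous_on_cong)
  then have "((\<lambda>u. h a + integral {a..u} (inv_deriv_sq \<sigma>)) has_real_derivative inv_deriv_sq \<sigma> (\<sigma> x))
      (at (\<sigma> x) within {a..b})"
    using e by (auto intro!: derivative_eq_intros integral_has_real_derivative simp: a_def b_def)
  then have "(h has_real_derivative inv_deriv_sq \<sigma> (\<sigma> x)) (at (\<sigma> x) within {a..b})"
  proof (rule has_field_derivative_transform_within[where d = 1])
    show "h a + integral {a..u} (inv_deriv_sq \<sigma>) = h u" if "u \<in> {a..b}" for u
    proof -
      have "a \<in> D" "u \<in> D" "a \<le> u" using that aD by auto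
      from integral_unique[OF h_integral[OF this]] show ?thesis by simp
    qed
    show "\<sigma> x \<in> {a..b}" using e by (simp add: a_def b_def)
  qed simp
  moreover have "at (\<sigma> x) within {a..b} = at (\<sigma> x)"
    using e by (intro at_within_Icc_at) (auto simp: a_def b_def)
  ultimately show ?thesis using assms by (simp add: inv_deriv_sq_eq)
qed

lemma continuous_scalar_bregman: "continuous_on D (scalar_bregman h H x)"
  unfolding scalar_bregman_def
  using DERIV_isCont[OF H_deriv] continuous_h
  by (intro continuous_intros) (auto simp: continuous_at_imp_continuous_on)

text \<open>A point with bounded coordinates and bounded divergence stays away from the finite ends of \<open>D\<close>,
  too: beyond a point \<open>m\<close> the divergence bounds \<open>h\<close>, and \<open>h\<close> bounds \<open>inv \<sigma>\<close>.\<close>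

lemma inv_bounded_on_scalar_bregman_sublevel:
  assumes x: "x \<in> D"
  shows "\<exists>C. \<forall>q\<in>D. \<bar>q\<bar> \<le> B \<and> scalar_bregman h H x q \<le> R \<longrightarrow> \<bar>inv \<sigma> q\<bar> \<le> C"
proof -
  have estimate: "\<bar>inv \<sigma> q\<bar> \<le> \<bar>inv \<sigma> m\<bar> + sqrt ((B + \<bar>m\<bar>) * (\<bar>R\<bar> / \<bar>m - x\<bar>))"
    if m: "m \<in> D" "x \<noteq> m" and q: "q \<in> D" "\<bar>q\<bar> \<le> B" "scalar_bregman h H x q \<le> R"
      and order: "x < m \<and> m \<le> q \<or> q \<le> m \<and> m < x" for m q
  proof -
    have prod: "(m - x) * (h q - h m) \<le> \<bar>R\<bar>"
      using h_growth_le_scalar_bregman[OF m(1) q(1), of x] scalar_bregman_nonneg[OF x m(1)] q(3)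
      by linarith
    have sgn: "(m - x) * (h q - h m) = \<bar>m - x\<bar> * \<bar>h q - h m\<bar>"
      using order h_mono[OF m(1) q(1)] h_mono[OF q(1) m(1)] by (auto simp: abs_mult[symmetric] mult_nonpos_nonpos)
    have bound_h: "\<bar>h q - h m\<bar> \<le> \<bar>R\<bar> / \<bar>m - x\<bar>"
      using prod m(2) by (simp add: sgn field_simps)
    have "(inv \<sigma> q - inv \<sigma> m)\<^sup>2 \<le> \<bar>q - m\<bar> * \<bar>h q - h m\<bar>"
      using inv_increment_sq_le[OF m(1) q(1)] inv_increment_sq_le[OF q(1) m(1)]
        h_mono[OF m(1) q(1)] h_mono[OF q(1) m(1)]
      by (cases "m \<le> q") (auto simp: power2_commute)
    also have "\<dots> \<le> (B + \<bar>m\<bar>) * (\<bar>R\<bar> / \<bar>m - x\<bar>)"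
      using bound_h q(2) by (intro mult_mono) auto
    finally have "sqrt ((inv \<sigma> q - inv \<sigma> m)\<^sup>2) \<le> sqrt ((B + \<bar>m\<bar>) * (\<bar>R\<bar> / \<bar>m - x\<bar>))"
      by (rule real_sqrt_le_mono)
    then have "\<bar>inv \<sigma> q - inv \<sigma> m\<bar> \<le> sqrt ((B + \<bar>m\<bar>) * (\<bar>R\<bar> / \<bar>m - x\<bar>))"
      unfolding real_sqrt_abs .
    then show ?thesis by linarith
  qed
  obtain e where e: "0 < e" "cball x e \<subseteq> D"
    using open_D x by (auto simp: open_contains_cball)
  define m1 m2 where "m1 = x - e" and "m2 = x + e"
  have m: "m1 \<in> D" "m2 \<in> D" "m1 < x" "x < m2" "{m1..m2} \<subseteq> D"
    using e by (auto simp: m1_def m2_def cball_def dist_real_def subset_iff)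
  have "compact (inv \<sigma> ` {m1..m2})"
    using m(5) by (intro compact_continuous_image continuous_on_subset[OF continuous_inv]) auto
  then obtain C where "\<forall>y \<in> inv \<sigma> ` {m1..m2}. \<bar>y\<bar> \<le> C"
    using compact_imp_bounded bounded_real by blast
  then have C: "\<bar>inv \<sigma> q\<bar> \<le> C" if "q \<in> {m1..m2}" for q
    using that by blast
  show ?thesis
  proof (intro exI ballI impI)
    fix q assume q: "q \<in> D" and bounds: "\<bar>q\<bar> \<le> B \<and> scalar_bregman h H x q \<le> R"
    show "\<bar>inv \<sigma> q\<bar> \<le> max C (max (\<bar>inv \<sigma> m1\<bar> + sqrt ((B + \<bar>m1\<bar>) * (\<bar>R\<bar> / \<bar>m1 - x\<bar>)))
        (\<bar>inv \<sigma> m2\<bar> + sqrt ((B + \<bar>m2\<bar>) * (\<bar>R\<bar> / \<bar>m2 - x\<bar>))))"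
    proof -
      consider "q \<in> {m1..m2}" | "q \<le> m1" | "m2 \<le> q" by fastforce
      then show ?thesis
      proof cases
        case 1
        from C[OF this] show ?thesis by (rule max.coboundedI1)
      next
        case 2
        have "\<bar>inv \<sigma> q\<bar> \<le> \<bar>inv \<sigma> m1\<bar> + sqrt ((B + \<bar>m1\<bar>) * (\<bar>R\<bar> / \<bar>m1 - x\<bar>))"
          by (rule estimate) (use 2 m q bounds in auto)
        then show ?thesis by (intro max.coboundedI2 max.coboundedI1)
      next
        case 3
        have "\<bar>inv \<sigma> q\<bar> \<le> \<bar>inv \<sigma> m2\<bar> + sqrt ((B + \<bar>m2\<bar>) * (\<bar>R\<bar> / \<bar>m2 - x\<bar>))"
          by (rule estimate) (use 3 m q bounds in auto)
        then show ?thesis by (intro max.coboundedI2)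
      qed
    qed
  qed
qed

end

section \<open>Entrywise maps and separable potentials\<close>

lemma entrywise_nth [simp]: "entrywise f x $ i = f (x $ i)"
  by (simp add: entrywise_def)

lemma has_derivative_vec_componentwise:
  fixes f :: "'a::real_normed_vector \<Rightarrow> real ^ 'n"
  assumes "\<And>i. ((\<lambda>x. f x $ i) has_derivative (\<lambda>d. f' d $ i)) (at x within S)"
  shows "(f has_derivative f') (at x within S)"
  using assms
  by (subst has_derivative_componentwise_within) (auto simp: Basis_vec_def inner_axis)

lemma entrywise_has_derivative:
  fixes x :: "real ^ 'n"
  assumes "\<And>i. (f has_real_derivative f' (x $ i)) (at (x $ i))"
  shows "(entrywise f has_derivative (\<lambda>d. \<chi> i. f' (x $ i) * d $ i)) (at x)"
proof (rule has_derivative_vec_componentwise)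
  fix i
  have "((\<lambda>x. x $ i) has_derivative (\<lambda>d. d $ i)) (at x)"
    by (rule bounded_linear_imp_has_derivative[OF bounded_linear_vec_nth])
  from has_derivative_compose[OF this assms[of i, unfolded has_field_derivative_def]]
  show "((\<lambda>x. entrywise f x $ i) has_derivative (\<lambda>d. (\<chi> i. f' (x $ i) * d $ i) $ i)) (at x)"
    by (simp only: entrywise_nth vec_lambda_beta)
qed

lemma continuous_on_entrywise:
  "continuous_on UNIV f \<Longrightarrow> continuous_on S (entrywise f :: real ^ 'n \<Rightarrow> real ^ 'n)"
  unfolding entrywise_def
  by (rule continuous_on_vec_lambda, erule continuous_on_compose2) (auto intro!: continuous_intros)

lemma GDERIV_imp_gradient: "GDERIV f x :> g \<Longrightarrow> gradient f x = g"
proof (unfold gradient_def, rule the_equality)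
  fix g' assume "GDERIV f x :> g" "GDERIV f x :> g'"
  then have "(\<lambda>d. inner d g') = (\<lambda>d. inner d g)"
    unfolding gderiv_def by (rule has_derivative_unique[rotated])
  then show "g' = g" by (metis vector_eq_ldot)
qed

text \<open>The gradient of \<open>g \<circ> entrywise \<sigma>\<close> in terms of the gradient \<open>g'\<close> of \<open>g\<close>.\<close>

definition pullback_gradient ::
    "(real \<Rightarrow> real) \<Rightarrow> (real ^ 'n \<Rightarrow> real ^ 'n) \<Rightarrow> real ^ 'n \<Rightarrow> real ^ 'n" where
  "pullback_gradient \<sigma> g' x = (\<chi> i. deriv \<sigma> (x $ i) * g' (entrywise \<sigma> x) $ i)"

lemma GDERIV_entrywise_compose:
  fixes g :: "real ^ 'n \<Rightarrow> real"
  assumes \<sigma>: "\<And>x. (\<sigma> has_real_derivative deriv \<sigma> x) (at x)"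
    and g: "GDERIV g (entrywise \<sigma> x) :> g' (entrywise \<sigma> x)"
  shows "GDERIV (\<lambda>x. g (entrywise \<sigma> x)) x :> pullback_gradient \<sigma> g' x"
proof -
  have "((\<lambda>x. g (entrywise \<sigma> x)) has_derivative
      (\<lambda>d. inner (\<chi> i. deriv \<sigma> (x $ i) * d $ i) (g' (entrywise \<sigma> x)))) (at x)"
    by (rule has_derivative_compose[OF entrywise_has_derivative[of \<sigma> "deriv \<sigma>" x, OF \<sigma>] g[unfolded gderiv_def]])
  then show ?thesis
    by (simp add: gderiv_def pullback_gradient_def inner_vec_def mult_ac)
qed

lemma continuous_on_pullback_gradient:
  assumes "continuous_on UNIV \<sigma>" "continuous_on UNIV (deriv \<sigma>)" "continuous_on UNIV g'"
  shows "continuous_on UNIV (pullback_gradient \<sigma> g')"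
proof -
  have "continuous_on UNIV (\<lambda>x. deriv \<sigma> (x $ i) * g' (entrywise \<sigma> x) $ i)" for i
    by (rule continuous_on_mult[OF continuous_on_compose2[OF assms(2) _ subset_UNIV]
          continuous_on_component[OF continuous_on_compose2[OF assms(3)
            continuous_on_entrywise[OF assms(1)] subset_UNIV]]])
       (auto intro!: continuous_intros)
  then show ?thesis unfolding pullback_gradient_def by (rule continuous_on_vec_lambda)
qed

lemma convex_on_above_gradient:
  fixes f :: "'a::real_inner \<Rightarrow> real"
  assumes "convex_on UNIV f" and f': "GDERIV f p :> g"
  shows "f p + inner g (x - p) \<le> f x"
proof -
  have "convex_on UNIV (\<lambda>s::real. f (p + s *\<^sub>R (x - p)))"
  proof (rule convex_onI)
    fix t a b :: real assume t: "0 < t" "t < 1"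
    have "p + ((1 - t) *\<^sub>R a + t *\<^sub>R b) *\<^sub>R (x - p) =
        (1 - t) *\<^sub>R (p + a *\<^sub>R (x - p)) + t *\<^sub>R (p + b *\<^sub>R (x - p))"
      by (simp add: algebra_simps)
    then show "f (p + ((1 - t) *\<^sub>R a + t *\<^sub>R b) *\<^sub>R (x - p)) \<le>
        (1 - t) * f (p + a *\<^sub>R (x - p)) + t * f (p + b *\<^sub>R (x - p))"
      using convex_onD[OF assms(1), of t] t by simp
  qed simp
  moreover have "((\<lambda>s. f (p + s *\<^sub>R (x - p))) has_real_derivative inner g (x - p)) (at 0 within UNIV)"
  proof -
    have "((\<lambda>s. p + s *\<^sub>R (x - p)) has_derivative (\<lambda>s. s *\<^sub>R (x - p))) (at 0)"
      by (auto intro!: derivative_eq_intros)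
    then have "((\<lambda>s. f (p + s *\<^sub>R (x - p))) has_derivative (\<lambda>s. inner (s *\<^sub>R (x - p)) g)) (at 0)"
      by (rule has_derivative_compose) (use f' in \<open>simp add: gderiv_def\<close>)
    then show ?thesis
      by (simp add: has_field_derivative_def inner_commute mult_commute_abs)
  qed
  ultimately have "f (p + 1 *\<^sub>R (x - p)) - f (p + 0 *\<^sub>R (x - p)) \<ge> inner g (x - p) * (1 - 0)"
    by (intro convex_on_imp_above_tangent[of UNIV]) auto
  then show ?thesis by simp
qed

context reparametrization
begin

definition vec_bregman :: "real ^ 'n \<Rightarrow> real ^ 'n \<Rightarrow> real" where
  "vec_bregman x q = (\<Sum>i\<in>UNIV. scalar_bregman h H (x $ i) (q $ i))"

lemma entrywise_in_vecs [simp]: "entrywise \<sigma> x \<in> vecs_in D"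
  by (simp add: vecs_in_def)

lemma gradient_sum_potential:
  fixes q :: "real ^ 'n"
  assumes "q \<in> vecs_in D"
  shows "gradient (sum_potential H) q = entrywise h q"
proof (rule GDERIV_imp_gradient)
  have "((\<lambda>z. H (z $ i)) has_derivative (\<lambda>d. h (q $ i) * d $ i)) (at q)" for i
  proof -
    have "(H has_derivative (*) (h (q $ i))) (at (q $ i))"
      using H_deriv[of "q $ i"] assms by (simp add: vecs_in_def has_field_derivative_def)
    from has_derivative_compose[OF bounded_linear_imp_has_derivative[OF bounded_linear_vec_nth] this]
    show ?thesis .
  qed
  then have "((\<lambda>z. \<Sum>i\<in>UNIV. H (z $ i)) has_derivative (\<lambda>d. \<Sum>i\<in>UNIV. h (q $ i) * d $ i)) (at q)"
    by (intro has_derivative_sum)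
  then show "GDERIV (sum_potential H) q :> entrywise h q"
    by (simp add: gderiv_def sum_potential_def[abs_def] inner_vec_def mult.commute)
qed

lemma bregman_sum_potential:
  "q \<in> vecs_in D \<Longrightarrow> bregman (sum_potential H) x q = vec_bregman x q"
  by (simp add: bregman_def gradient_sum_potential vec_bregman_def scalar_bregman_def
      sum_potential_def inner_vec_def sum_subtractf)

lemma scalar_le_vec_bregman:
  assumes "x \<in> vecs_in D" "q \<in> vecs_in D"
  shows "scalar_bregman h H (x $ i) (q $ i) \<le> vec_bregman x q"
  unfolding vec_bregman_def
  by (rule member_le_sum[of i UNIV "\<lambda>i. scalar_bregman h H (x $ i) (q $ i)"])
     (use assms in \<open>auto simp: vecs_in_def intro!: scalar_bregman_nonneg\<close>)

lemma vec_bregman_nonneg: "x \<in> vecs_in D \<Longrightarrow> q \<in> vecs_in D \<Longrightarrow> 0 \<le> vec_bregman x q"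
  unfolding vec_bregman_def by (intro sum_nonneg scalar_bregman_nonneg) (auto simp: vecs_in_def)

lemma vec_bregman_pos:
  assumes "x \<in> vecs_in D" "q \<in> vecs_in D" "x \<noteq> q"
  shows "0 < vec_bregman x q"
proof -
  obtain i where "x $ i \<noteq> q $ i" using assms(3) by (auto simp: vec_eq_iff)
  then have "0 < scalar_bregman h H (x $ i) (q $ i)"
    using assms by (intro scalar_bregman_pos) (auto simp: vecs_in_def)
  also have "\<dots> \<le> vec_bregman x q" using assms by (intro scalar_le_vec_bregman)
  finally show ?thesis .
qed

lemma vec_bregman_self [simp]: "vec_bregman x x = 0"
  by (simp add: vec_bregman_def scalar_bregman_def)

lemma continuous_vec_bregman: "continuous_on (vecs_in D) (vec_bregman x)"
  unfolding vec_bregman_def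
  by (rule continuous_on_sum, rule continuous_on_compose2[OF continuous_scalar_bregman])
     (auto simp: vecs_in_def intro!: continuous_intros)

text \<open>Every coordinate is bounded and has bounded divergence, so it keeps away from both ends of \<open>D\<close>,
  where its parameter \<open>inv \<sigma>\<close> would be unbounded.\<close>

lemma bounded_parameters:
  fixes x :: "real ^ 'n"
  assumes x: "x \<in> vecs_in D"
    and bdd: "bounded (entrywise \<sigma> ` W)" and sublevel: "\<And>v. v \<in> W \<Longrightarrow> vec_bregman x (entrywise \<sigma> v) \<le> R"
  shows "bounded W"
proof -
  obtain B where B: "\<And>v. v \<in> W \<Longrightarrow> norm (entrywise \<sigma> v) \<le> B"
    using bdd by (auto simp: bounded_iff)
  have "\<exists>C. \<forall>v\<in>W. \<bar>v $ i\<bar> \<le> C" for i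
  proof -
    obtain C where C: "\<And>q. q \<in> D \<Longrightarrow> \<bar>q\<bar> \<le> B \<Longrightarrow> scalar_bregman h H (x $ i) q \<le> R \<Longrightarrow> \<bar>inv \<sigma> q\<bar> \<le> C"
      using inv_bounded_on_scalar_bregman_sublevel[of "x $ i" B R] x by (auto simp: vecs_in_def)
    have "\<bar>v $ i\<bar> \<le> C" if "v \<in> W" for v
      using C[of "\<sigma> (v $ i)"] component_le_norm_cart[of "entrywise \<sigma> v" i] B[OF that]
        scalar_le_vec_bregman[OF x, of "entrywise \<sigma> v" i] sublevel[OF that] by simp
    then show ?thesis by blast
  qed
  then obtain C where C: "\<And>i v. v \<in> W \<Longrightarrow> \<bar>v $ i\<bar> \<le> C i" by metis
  have "norm v \<le> (\<Sum>i\<in>UNIV. C i)" if "v \<in> W" for v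
    using norm_le_l1_cart[of v] sum_mono[of UNIV "\<lambda>i. \<bar>v $ i\<bar>" C] C[OF that] by simp
  then show ?thesis by (auto simp: bounded_iff)
qed

end

section \<open>Continuation of bounded solutions\<close>

text \<open>The velocity is bounded on the closure of the trajectory, so the solution is Lipschitz
  continuous and extends continuously to the closed interval.\<close>

lemma bounded_solution_has_limit:
  fixes w :: "real \<Rightarrow> 'a::euclidean_space"
  assumes T: "0 < T" and contf: "continuous_on UNIV f"
    and sol: "\<And>t. t \<in> time_dom (ereal T) \<Longrightarrow>
        (w has_vector_derivative f (w t)) (at t within time_dom (ereal T))"
    and bdd: "bounded (w ` time_dom (ereal T))"
  obtains l where "(w \<longlongrightarrow> l) (at_left T)"
proof -
  have dom: "time_dom (ereal T) = {0..<T}" by (auto simp: time_dom_def)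
  have "compact (f ` closure (w ` {0..<T}))"
    using bdd by (intro compact_continuous_image continuous_on_subset[OF contf]) (auto simp: dom)
  then obtain M where M: "0 < M" "\<forall>y \<in> f ` closure (w ` {0..<T}). norm y \<le> M"
    using bounded_pos[THEN iffD1, OF compact_imp_bounded] by blast
  have "norm (w s - w t) \<le> M * norm (s - t)" if "s \<in> {0..<T}" "t \<in> {0..<T}" for s t
  proof (rule differentiable_bound[OF _ _ _ that])
    show "(w has_derivative (\<lambda>d. d *\<^sub>R f (w r))) (at r within {0..<T})" if "r \<in> {0..<T}" for r
      using sol[of r] that by (simp add: dom has_vector_derivative_def)
    show "onorm (\<lambda>d. d *\<^sub>R f (w r)) \<le> M" if "r \<in> {0..<T}" for r
    proof (rule onorm_le)
      fix d :: real
      have "w r \<in> closure (w ` {0..<T})"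
        using that by (intro closure_subset[THEN subsetD] imageI)
      then have "norm (f (w r)) \<le> M" using M(2) by (intro bspec[OF M(2)] imageI)
      then show "norm (d *\<^sub>R f (w r)) \<le> M * norm d"
        using mult_right_mono[of "norm (f (w r))" M "\<bar>d\<bar>"] by (simp add: mult.commute)
    qed
  qed simp
  then have "M-lipschitz_on {0..<T} w"
    using M(1) by (intro lipschitz_onI) (auto simp: dist_norm)
  then have "uniformly_continuous_on {0..<T} w" by (rule lipschitz_on_uniformly_continuous)
  then obtain g where g: "uniformly_continuous_on (closure {0..<T}) g"
    "\<And>t. t \<in> {0..<T} \<Longrightarrow> w t = g t"
    using uniformly_continuous_on_extension_on_closure by metis
  have "continuous_on {0..T} g"
    using uniformly_continuous_imp_continuous[OF g(1)] T by simp
  then have "(g \<longlongrightarrow> g T) (at T within {0..T})"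
    using T by (auto simp: continuous_on_def)
  then have "(g \<longlongrightarrow> g T) (at_left T)"
    using T by (simp add: at_within_Icc_at_left)
  moreover have "\<forall>\<^sub>F t in at_left T. g t = w t"
    unfolding eventually_at_left_field using T g(2) by (intro exI[of _ 0]) auto
  ultimately have "(w \<longlongrightarrow> g T) (at_left T)"
    by (rule Lim_transform_eventually)
  then show ?thesis by (rule that)
qed

text \<open>A Peano solution is attached at the limit. Both pieces solve the equation away from the joint,
  where the combined function is continuous.\<close>

lemma solution_extends_beyond_limit:
  fixes w :: "real \<Rightarrow> 'a::euclidean_space"
  assumes T: "0 < T" and contf: "continuous_on UNIV f"
    and sol: "\<And>t. t \<in> time_dom (ereal T) \<Longrightarrow>
        (w has_vector_derivative f (w t)) (at t within time_dom (ereal T))"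
    and lim: "(w \<longlongrightarrow> l) (at_left T)"
  obtains \<epsilon> :: real and W where "0 < \<epsilon>" "\<And>t. t \<in> time_dom (ereal T) \<Longrightarrow> W t = w t"
    "\<And>t. t \<in> time_dom (ereal T + ereal \<epsilon>) \<Longrightarrow>
       (W has_vector_derivative f (W t)) (at t within time_dom (ereal T + ereal \<epsilon>))"
proof -
  obtain \<epsilon> u where \<epsilon>: "0 < \<epsilon>" and u: "u 0 = l"
    "\<And>t. t \<in> {0..\<epsilon>} \<Longrightarrow> (u has_vector_derivative f (u t)) (at t within {0..\<epsilon>})"
    using Peano_existence[OF contf, of l] by blast
  define W where "W t = (if t < T then w t else u (t - T))" for t
  have dom: "time_dom (ereal T) = {0..<T}" "time_dom (ereal (T + \<epsilon>)) = {0..<T + \<epsilon>}"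
    by (auto simp: time_dom_def)
  have before: "(W has_vector_derivative f (W t)) (at t within {0..<T + \<epsilon>})"
    if "t \<in> {0..<T}" for t
  proof -
    have "at t within {0..<T + \<epsilon>} = at t within {0..<T}"
      using that \<epsilon> by (intro at_within_nhd[of t "{..<T}"]) auto
    moreover have "(W has_vector_derivative f (w t)) (at t within {0..<T})"
      by (rule has_vector_derivative_transform[OF that _ sol[unfolded dom, OF that]]) (simp add: W_def)
    ultimately show ?thesis using that by (simp add: W_def)
  qed
  have after: "(W has_vector_derivative f (W t)) (at t within {0..<T + \<epsilon>})"
    if "t \<in> {T<..<T + \<epsilon>}" for t
  proof -
    have "(u has_vector_derivative f (u (t - T))) (at (t - T))"
      using u(2)[of "t - T"] that at_within_Icc_at[of 0 "t - T" \<epsilon>] by auto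
    moreover have "((\<lambda>t. t - T) has_vector_derivative 1) (at t)"
      by (auto intro!: derivative_eq_intros)
    ultimately have "((\<lambda>t. u (t - T)) has_vector_derivative f (u (t - T))) (at t)"
      using vector_diff_chain_at[of "\<lambda>t. t - T" 1 t u] by (simp add: o_def)
    then have "(W has_vector_derivative f (u (t - T))) (at t)"
      by (rule has_vector_derivative_transform_within_open[of _ _ _ "{T<..}"])
         (use that in \<open>auto simp: W_def\<close>)
    then show ?thesis using that by (simp add: W_def has_vector_derivative_at_within)
  qed
  have "(W \<longlongrightarrow> l) (at T)"
  proof (rule filterlim_split_at)
    have "\<forall>\<^sub>F t in at_left T. w t = W t"
      unfolding eventually_at_left_field using T by (intro exI[of _ 0]) (auto simp: W_def)
    with lim show "(W \<longlongrightarrow> l) (at_left T)" by (rule Lim_transform_eventually)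
    have "(u \<longlongrightarrow> u 0) (at 0 within {0..\<epsilon>})"
      using has_vector_derivative_continuous[OF u(2)[of 0]] \<epsilon> by (simp add: continuous_within)
    then have "(u \<longlongrightarrow> l) (at_right 0)"
      using \<epsilon> u(1) by (simp add: at_within_Icc_at_right)
    then have "((\<lambda>t. u (t - T)) \<longlongrightarrow> l) (at_right T)"
      by (simp add: filterlim_at_right_to_0[of _ _ T])
    moreover have "\<forall>\<^sub>F t in at_right T. u (t - T) = W t"
      unfolding eventually_at_right_field using T by (intro exI[of _ "T + 1"]) (auto simp: W_def)
    ultimately show "(W \<longlongrightarrow> l) (at_right T)" by (rule Lim_transform_eventually)
  qed
  moreover have "W T = l" using u(1) by (simp add: W_def)
  ultimately have at_T: "isCont W T" by (simp add: isCont_def)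
  have contW: "continuous_on {0..<T + \<epsilon>} W"
    unfolding continuous_on_eq_continuous_within
  proof
    fix t assume "t \<in> {0..<T + \<epsilon>}"
    then consider "t \<in> {0..<T}" | "t = T" | "t \<in> {T<..<T + \<epsilon>}" by fastforce
    then show "continuous (at t within {0..<T + \<epsilon>}) W"
      by cases (use before after at_T in
          \<open>auto intro: has_vector_derivative_continuous continuous_at_imp_continuous_at_within\<close>)
  qed
  have "(W has_vector_derivative f (W t)) (at t within {0..<T + \<epsilon>})" if "t \<in> {0..<T + \<epsilon>}" for t
  proof (rule has_vector_derivative_across_finite_set[of "{T}" "ereal (T + \<epsilon>)" W, unfolded dom])
    show "continuous_on {0..<T + \<epsilon>} (\<lambda>t. f (W t))"
      using continuous_on_compose2[OF contf contW] by auto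
    show "(W has_vector_derivative f (W t)) (at t within {0..<T + \<epsilon>})"
      if "t \<in> {0..<T + \<epsilon>}" "t \<notin> {T}" for t
      using before[of t] after[of t] that by (cases "t < T") auto
  qed (use contW that in auto)
  then show ?thesis
    using \<epsilon> by (intro that[of \<epsilon> W]) (auto simp: dom W_def)
qed

section \<open>The flow in the reparametrized variable\<close>

locale mirror_flow = reparametrization \<sigma> D h H
  for \<sigma> :: "real \<Rightarrow> real" and D :: "real set" and h H :: "real \<Rightarrow> real" +
  fixes Lt :: "real ^ 'n \<Rightarrow> real" and gL :: "real ^ 'n \<Rightarrow> real ^ 'n"
    and T :: ereal and w :: "real \<Rightarrow> real ^ 'n"
  assumes Lt_gradient: "\<And>z. GDERIV Lt z :> gL z"
    and continuous_gL: "continuous_on UNIV gL"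
    and Lt_convex: "convex_on UNIV Lt"
    and Lt_nonneg: "\<And>z. 0 \<le> Lt z"
    and T_pos: "0 < T"
    and finite_critical_times: "finite (critical_times \<sigma> T w)"
    and flow: "\<And>t. t \<in> time_dom T \<Longrightarrow>
      (w has_vector_derivative - pullback_gradient \<sigma> gL (w t)) (at t within time_dom T)"
begin

abbreviation wt :: "real \<Rightarrow> real ^ 'n" where
  "wt t \<equiv> entrywise \<sigma> (w t)"

lemma w_component_deriv:
  assumes "t \<in> time_dom T"
  shows "((\<lambda>s. w s $ i) has_real_derivative - (deriv \<sigma> (w t $ i) * gL (wt t) $ i))
           (at t within time_dom T)"
  using bounded_linear.has_vector_derivative[OF bounded_linear_vec_nth flow[OF assms], of i]
  by (simp add: has_real_derivative_iff_has_vector_derivative pullback_gradient_def)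

lemma wt_component_deriv:
  assumes "t \<in> time_dom T"
  shows "((\<lambda>s. \<sigma> (w s $ i)) has_real_derivative - ((deriv \<sigma> (w t $ i))\<^sup>2 * gL (wt t) $ i))
           (at t within time_dom T)"
  using DERIV_chain2[OF \<sigma>_deriv w_component_deriv[OF assms, of i]]
  by (simp add: power2_eq_square mult.assoc)

lemma continuous_w: "continuous_on (time_dom T) w"
  using flow by (auto simp: continuous_on_eq_continuous_within intro: has_vector_derivative_continuous)

lemma continuous_wt: "continuous_on (time_dom T) wt"
  by (rule continuous_on_compose2[OF continuous_on_entrywise[OF continuous_\<sigma>] continuous_w subset_UNIV])

lemma loss_deriv:
  assumes "t \<in> time_dom T"
  shows "((\<lambda>s. Lt (wt s)) has_real_derivative - (norm (pullback_gradient \<sigma> gL (w t)))\<^sup>2)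
           (at t within time_dom T)"
proof -
  have "((\<lambda>x. Lt (entrywise \<sigma> x)) has_derivative (\<lambda>d. inner d (pullback_gradient \<sigma> gL (w t)))) (at (w t))"
    using GDERIV_entrywise_compose[where g = Lt and g' = gL, OF \<sigma>_deriv Lt_gradient, of "w t"]
    by (simp add: gderiv_def)
  from has_derivative_compose[OF flow[OF assms, unfolded has_vector_derivative_def] this]
  show ?thesis
    unfolding has_field_derivative_def
    by (rule has_derivative_eq_rhs) (simp add: fun_eq_iff power2_norm_eq_inner)
qed

text \<open>The factor \<open>(\<sigma>')\<^sup>2\<close> of the reparametrized flow cancels against the derivative of \<open>h\<close>: the dual
  variable \<open>h \<circ> wt\<close> moves along the plain gradient of the convex loss. Chain rule and
  cancellation need \<open>\<sigma>' \<noteq> 0\<close>; at the finitely many other times the formula follows by continuity.\<close>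

lemma mirror_deriv:
  assumes t: "t \<in> time_dom T"
  shows "((\<lambda>s. h (\<sigma> (w s $ i))) has_real_derivative - (gL (wt t) $ i)) (at t within time_dom T)"
  unfolding has_real_derivative_iff_has_vector_derivative
proof (rule has_vector_derivative_across_finite_set[OF finite_critical_times _ _ _ t])
  have "continuous_on (time_dom T) (\<lambda>t. \<sigma> (w t $ i))"
    using continuous_on_component[OF continuous_wt, of i] by simp
  then show "continuous_on (time_dom T) (\<lambda>s. h (\<sigma> (w s $ i)))"
    by (rule continuous_on_compose2[OF continuous_h]) auto
  show "continuous_on (time_dom T) (\<lambda>t. - (gL (wt t) $ i))"
    by (rule continuous_on_minus[OF continuous_on_component[OF
          continuous_on_compose2[OF continuous_gL continuous_wt subset_UNIV]]])
  fix t assume t: "t \<in> time_dom T" "t \<notin> critical_times \<sigma> T w"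
  then have nz: "deriv \<sigma> (w t $ i) \<noteq> 0" by (auto simp: critical_times_def)
  from DERIV_chain2[OF h_deriv[OF nz] wt_component_deriv[OF t(1), of i]]
  show "((\<lambda>s. h (\<sigma> (w s $ i))) has_vector_derivative - (gL (wt t) $ i)) (at t within time_dom T)"
    using nz by (simp add: has_real_derivative_iff_has_vector_derivative)
qed

text \<open>In \<open>H x - H q - h q (x - q)\<close> the two terms with the velocity of \<open>q\<close> cancel, and only the
  derivative of the dual variable \<open>h q\<close> is left.\<close>

lemma bregman_deriv:
  assumes x: "x \<in> vecs_in D" and t: "t \<in> time_dom T"
  shows "((\<lambda>s. vec_bregman x (wt s)) has_real_derivative inner (gL (wt t)) (x - wt t))
           (at t within time_dom T)"
proof -
  have "((\<lambda>s. scalar_bregman h H (x $ i) (\<sigma> (w s $ i))) has_real_derivative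
      gL (wt t) $ i * (x $ i - \<sigma> (w t $ i))) (at t within time_dom T)" for i
    unfolding scalar_bregman_def
    by (rule derivative_eq_intros DERIV_chain2[OF H_deriv] wt_component_deriv[OF t] mirror_deriv[OF t]
          \<sigma>_in_D refl)+ (simp add: algebra_simps)
  then have "((\<lambda>s. \<Sum>i\<in>UNIV. scalar_bregman h H (x $ i) (\<sigma> (w s $ i))) has_real_derivative
      (\<Sum>i\<in>UNIV. gL (wt t) $ i * (x $ i - \<sigma> (w t $ i)))) (at t within time_dom T)"
    by (intro DERIV_sum)
  then show ?thesis by (simp add: vec_bregman_def inner_vec_def)
qed

lemma bregman_deriv_le:
  assumes "Lt x = 0"
  shows "inner (gL (wt t)) (x - wt t) \<le> - Lt (wt t)"
  using convex_on_above_gradient[OF Lt_convex Lt_gradient, of "wt t" x] assms by simp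

lemma bregman_decreasing:
  assumes x: "x \<in> vecs_in D" "Lt x = 0" and st: "0 \<le> s" "s \<le> t" "t \<in> time_dom T"
  shows "vec_bregman x (wt t) \<le> vec_bregman x (wt s)"
proof -
  have sub: "{s..t} \<subseteq> time_dom T" using atLeastAtMost_subset_time_dom st by blast
  show ?thesis
  proof (rule time_dom_decreasing[OF st(2) sub bregman_deriv[OF x(1)]])
    show "inner (gL (wt r)) (x - wt r) \<le> 0" for r
      using bregman_deriv_le[OF x(2), of r] Lt_nonneg[of "wt r"] by linarith
  qed (use sub in auto)
qed

text \<open>Along the flow \<open>vec_bregman x (wt t) + t * Lt (wt t)\<close> decreases: the first
  term loses at least \<open>Lt (wt t)\<close> per unit of time, which is what the growing weight of the decreasing
  loss can add.\<close>

lemma bregman_plus_weighted_loss_le: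
  assumes x: "x \<in> vecs_in D" "Lt x = 0" and t: "t \<in> time_dom T"
  shows "vec_bregman x (wt t) + t * Lt (wt t) \<le> vec_bregman x (wt 0)"
proof -
  have "0 \<le> t" using t by (simp add: time_dom_def)
  have sub: "{0..t} \<subseteq> time_dom T" using atLeastAtMost_subset_time_dom t by simp
  have "vec_bregman x (wt t) + t * Lt (wt t) \<le> vec_bregman x (wt 0) + 0 * Lt (wt 0)"
  proof (rule time_dom_decreasing[OF \<open>0 \<le> t\<close> sub, of "\<lambda>s. vec_bregman x (wt s) + s * Lt (wt s)"])
    fix s assume s: "s \<in> {0..t}"
    then have sT: "s \<in> time_dom T" using sub by blast
    show "((\<lambda>s. vec_bregman x (wt s) + s * Lt (wt s)) has_real_derivative
        (inner (gL (wt s)) (x - wt s) + (1 * Lt (wt s) + - (norm (pullback_gradient \<sigma> gL (w s)))\<^sup>2 * s)))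
        (at s within time_dom T)"
      by (intro DERIV_add DERIV_mult DERIV_ident bregman_deriv[OF x(1) sT] loss_deriv[OF sT])
    have "0 \<le> (norm (pullback_gradient \<sigma> gL (w s)))\<^sup>2 * s" using s by simp
    then show "inner (gL (wt s)) (x - wt s) +
        (1 * Lt (wt s) + - (norm (pullback_gradient \<sigma> gL (w s)))\<^sup>2 * s) \<le> 0"
      using bregman_deriv_le[OF x(2), of s] by simp
  qed
  then show ?thesis by simp
qed

lemma loss_le_bregman_over_time:
  assumes x: "x \<in> vecs_in D" "Lt x = 0" and t: "t \<in> time_dom T" "0 < t"
  shows "Lt (wt t) \<le> vec_bregman x (wt 0) / t"
  using bregman_plus_weighted_loss_le[OF x t(1)] vec_bregman_nonneg[OF x(1), of "wt t"] t(2)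
  by (simp add: field_simps)

lemma loss_tendsto_zero:
  assumes x: "x \<in> vecs_in D" "Lt x = 0" and "T = \<infinity>"
  shows "((\<lambda>t. Lt (wt t)) \<longlongrightarrow> 0) at_top"
proof (rule tendsto_sandwich[OF _ _ tendsto_const])
  show "\<forall>\<^sub>F t in at_top. Lt (wt t) \<le> vec_bregman x (wt 0) / t"
    using eventually_gt_at_top[of 0]
    by eventually_elim (use loss_le_bregman_over_time[OF x] assms(3) in \<open>simp add: time_dom_def\<close>)
  show "((\<lambda>t. vec_bregman x (wt 0) / t) \<longlongrightarrow> 0) at_top"
    by (intro tendsto_divide_0[OF tendsto_const] filterlim_at_top_imp_at_infinity filterlim_ident)
qed (use Lt_nonneg in simp)

text \<open>The loss decays at the rate \<open>\<Sum> (\<sigma>')\<^sup>2 (gL)\<^sup>2 \<ge> r \<parallel>gL\<parallel>\<^sup>2 \<ge> 2 r \<mu> Lt\<close>, since \<open>1 / inv_deriv_sq\<close> is \<open>(\<sigma>')\<^sup>2\<close> off the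
  critical values.\<close>

lemma exponential_decay:
  assumes PL: "\<And>z. 2 * \<mu> * Lt z \<le> (norm (gL z))\<^sup>2" and r: "0 \<le> r"
    and st: "s \<le> t" "{s..t} \<subseteq> time_dom T" "{s..t} \<inter> critical_times \<sigma> T w = {}"
    and speed: "\<And>q i. q \<in> {s..t} \<Longrightarrow> r \<le> 1 / inv_deriv_sq \<sigma> (wt q $ i)"
  shows "Lt (wt t) \<le> Lt (wt s) * exp (- 2 * r * \<mu> * (t - s))"
proof -
  let ?c = "2 * r * \<mu>"
  have "Lt (wt t) * exp (?c * (t - s)) \<le> Lt (wt s) * exp (?c * (s - s))"
  proof (rule time_dom_decreasing[OF st(1,2), of "\<lambda>q. Lt (wt q) * exp (?c * (q - s))"])
    fix q assume q: "q \<in> {s..t}"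
    let ?G = "(norm (pullback_gradient \<sigma> gL (w q)))\<^sup>2"
    have "((\<lambda>q. exp (?c * (q - s))) has_real_derivative exp (?c * (q - s)) * ?c) (at q within time_dom T)"
      by (rule derivative_eq_intros refl)+ simp
    from DERIV_mult[OF loss_deriv this]
    show "((\<lambda>q. Lt (wt q) * exp (?c * (q - s))) has_real_derivative
        (?c * Lt (wt q) - ?G) * exp (?c * (q - s))) (at q within time_dom T)"
      using q st(2) by (simp add: subset_iff algebra_simps)
    have "r \<le> (deriv \<sigma> (w q $ i))\<^sup>2" for i
    proof -
      have "q \<in> time_dom T" "q \<notin> critical_times \<sigma> T w" using q st by blast+
      then have "deriv \<sigma> (w q $ i) \<noteq> 0" by (auto simp: critical_times_def)
      then show ?thesis using speed[OF q, of i] by (simp add: inv_deriv_sq_eq)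
    qed
    then have "r * (norm (gL (wt q)))\<^sup>2 \<le> ?G"
      by (simp add: power2_norm_eq_inner inner_vec_def pullback_gradient_def sum_distrib_left
          power2_eq_square[symmetric] power_mult_distrib sum_mono mult_right_mono)
    moreover have "r * (2 * \<mu> * Lt (wt q)) \<le> r * (norm (gL (wt q)))\<^sup>2"
      using PL r by (rule mult_left_mono)
    ultimately have "?c * Lt (wt q) - ?G \<le> 0" by (simp add: mult_ac)
    then show "(?c * Lt (wt q) - ?G) * exp (?c * (q - s)) \<le> 0"
      by (simp add: mult_le_0_iff)
  qed
  then have "Lt (wt t) * exp (?c * (t - s)) * exp (- 2 * r * \<mu> * (t - s)) \<le>
      Lt (wt s) * exp (- 2 * r * \<mu> * (t - s))"
    by (intro mult_right_mono) auto
  moreover have "exp (?c * (t - s)) * exp (- 2 * r * \<mu> * (t - s)) = 1"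
    by (simp flip: exp_add)
  ultimately show ?thesis by (simp only: mult.assoc mult_1_right)
qed

text \<open>The divergence from a minimizer decreases along the flow, which gives the
  divergence bound for the parameters.\<close>

lemma bounded_w:
  assumes x: "x \<in> vecs_in D" "Lt x = 0" and bdd: "bounded (wt ` time_dom T)"
  shows "bounded (w ` time_dom T)"
proof (rule bounded_parameters[OF x(1)])
  show "bounded (entrywise \<sigma> ` w ` time_dom T)" using bdd by (simp add: image_image)
  show "vec_bregman x (entrywise \<sigma> v) \<le> vec_bregman x (wt 0)" if "v \<in> w ` time_dom T" for v
    using that bregman_decreasing[OF x, of 0] by (auto simp: time_dom_def)
qed

text \<open>The values \<open>wt n\<close> have a cluster point in \<open>vecs_in D\<close>, and it is a minimizer.
  Its divergence from \<open>wt t\<close> decreases in \<open>t\<close> and vanishes along a subsequence, hence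
  tends to zero.\<close>

lemma bounded_trajectory_converges:
  assumes x: "x \<in> vecs_in D" "Lt x = 0" and T: "T = \<infinity>" and bdd: "bounded (wt ` time_dom T)"
  obtains l where "l \<in> vecs_in D" "(wt \<longlongrightarrow> l) at_top" "Lt l = 0"
proof -
  obtain C where C: "\<And>t. t \<in> time_dom T \<Longrightarrow> norm (w t) \<le> C"
    using bounded_w[OF x bdd] by (auto simp: bounded_iff)
  define K :: "(real ^ 'n) set" where "K = entrywise \<sigma> ` cball 0 C"
  have K: "compact K" "K \<subseteq> vecs_in D"
    unfolding K_def
    by (auto intro!: compact_continuous_image continuous_on_entrywise[OF continuous_\<sigma>])
  have dom: "t \<in> time_dom T" if "0 \<le> t" for t using that T by (simp add: time_dom_def)
  have wt_K: "wt t \<in> K" if "0 \<le> t" for t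
    using C[OF dom[OF that]] by (auto simp: K_def)
  obtain l r where l: "l \<in> K" "strict_mono r" "((\<lambda>n. wt (real n)) \<circ> r) \<longlonglongrightarrow> l"
    using K(1) wt_K unfolding compact_def by (metis of_nat_0_le_iff)
  have lD: "l \<in> vecs_in D" using l(1) K(2) by blast
  have r_top: "filterlim (\<lambda>n. real (r n)) at_top sequentially"
    using filterlim_compose[OF filterlim_real_sequentially filterlim_subseq[OF l(2)]] .
  have "isCont Lt l"
    using Lt_gradient[of l] unfolding gderiv_def by (rule has_derivative_continuous)
  then have "(\<lambda>n. Lt (wt (real (r n)))) \<longlonglongrightarrow> Lt l"
    using l(3) by (auto simp: o_def intro: isCont_tendsto_compose)
  moreover have "(\<lambda>n. Lt (wt (real (r n)))) \<longlonglongrightarrow> 0"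
    by (rule filterlim_compose[OF loss_tendsto_zero[OF x T] r_top])
  ultimately have Lt_l: "Lt l = 0" by (rule LIMSEQ_unique)
  have lim_sub: "(\<lambda>n. vec_bregman l (wt (real (r n)))) \<longlonglongrightarrow> 0"
    using continuous_on_tendsto_compose[OF continuous_vec_bregman[of l] l(3) lD] by (simp add: o_def)
  have "\<forall>\<^sub>F t in at_top. dist (wt t) l < e" if "0 < e" for e
  proof (cases "K - ball l e = {}")
    case True
    then have "dist (wt t) l < e" if "0 \<le> t" for t
      using wt_K[OF that] by (auto simp: dist_commute)
    then show ?thesis by (auto simp: eventually_at_top_linorder intro: exI[of _ 0])
  next
    case False
    have "compact (K - ball l e)" using K(1) by (intro compact_diff) auto
    then obtain p where p: "p \<in> K - ball l e" "\<And>q. q \<in> K - ball l e \<Longrightarrow> vec_bregman l p \<le> vec_bregman l q"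
      using continuous_attains_inf[OF _ False continuous_on_subset[OF continuous_vec_bregman[of l]]] K(2)
      by blast
    have "0 < vec_bregman l p" using p(1) K(2) \<open>0 < e\<close> by (intro vec_bregman_pos lD) auto
    then have "\<forall>\<^sub>F n in sequentially. vec_bregman l (wt (real (r n))) < vec_bregman l p"
      using order_tendstoD(2)[OF lim_sub] by simp
    then obtain n where n: "vec_bregman l (wt (real (r n))) < vec_bregman l p"
      by (auto dest: eventually_happens)
    have "dist (wt t) l < e" if "real (r n) \<le> t" for t
    proof (rule ccontr)
      assume "\<not> dist (wt t) l < e"
      then have "wt t \<in> K - ball l e"
        using wt_K[of t] that by (auto simp: dist_commute)
      from p(2)[OF this] bregman_decreasing[OF lD Lt_l _ that dom] n that show False by fastforce
    qed
    then show ?thesis by (auto simp: eventually_at_top_linorder)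
  qed
  then have "(wt \<longlongrightarrow> l) at_top" by (rule tendstoI)
  with lD Lt_l show ?thesis by (intro that)
qed

text \<open>If \<open>T\<close> is finite, then a bounded trajectory has bounded parameters, which converge to a
  limit from which the flow continues. If \<open>T\<close> is infinite, then \<open>w\<close> itself is the extension.\<close>

lemma bounded_trajectory_extends:
  assumes x: "x \<in> vecs_in D" "Lt x = 0" and bdd: "bounded (wt ` time_dom T)"
  shows "\<exists>l. (wt \<longlongrightarrow> l) (end_time T)"
    and "\<exists>\<epsilon>::real>0. \<exists>W. (\<forall>t\<in>time_dom T. W t = w t) \<and> (\<forall>t\<in>time_dom (T + ereal \<epsilon>).
      (W has_vector_derivative - pullback_gradient \<sigma> gL (W t)) (at t within time_dom (T + ereal \<epsilon>)))"
proof -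
  have "(\<exists>l. (wt \<longlongrightarrow> l) (end_time T)) \<and>
      (\<exists>\<epsilon>::real>0. \<exists>W. (\<forall>t\<in>time_dom T. W t = w t) \<and> (\<forall>t\<in>time_dom (T + ereal \<epsilon>).
      (W has_vector_derivative - pullback_gradient \<sigma> gL (W t)) (at t within time_dom (T + ereal \<epsilon>))))"
  proof (cases T)
    case (real \<tau>)
    have \<tau>: "0 < \<tau>" using T_pos real by simp
    have cont: "continuous_on UNIV (\<lambda>x. - pullback_gradient \<sigma> gL x)"
      by (intro continuous_on_minus continuous_on_pullback_gradient continuous_\<sigma> continuous_deriv_\<sigma> continuous_gL)
    note sol = flow[unfolded real]
    obtain l where l: "(w \<longlongrightarrow> l) (at_left \<tau>)"
      using bounded_solution_has_limit[OF \<tau> cont sol] bounded_w[OF x bdd] real by auto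
    have "(wt \<longlongrightarrow> entrywise \<sigma> l) (end_time T)"
      using continuous_on_tendsto_compose[OF continuous_on_entrywise[OF continuous_\<sigma>, of UNIV] l] real
      by (simp add: end_time_def)
    moreover obtain \<epsilon> :: real and W where "0 < \<epsilon>" "\<And>t. t \<in> time_dom (ereal \<tau>) \<Longrightarrow> W t = w t"
      "\<And>t. t \<in> time_dom (ereal \<tau> + ereal \<epsilon>) \<Longrightarrow> (W has_vector_derivative
         - pullback_gradient \<sigma> gL (W t)) (at t within time_dom (ereal \<tau> + ereal \<epsilon>))"
      using solution_extends_beyond_limit[OF \<tau> cont sol l] by blast
    ultimately show ?thesis unfolding real by blast
  next
    case PInf
    obtain l where "(wt \<longlongrightarrow> l) at_top"
      by (rule bounded_trajectory_converges[OF x PInf bdd])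
    then have "(wt \<longlongrightarrow> l) (end_time T)" by (simp add: PInf end_time_def)
    moreover have "T + ereal 1 = T" by (simp add: PInf)
    ultimately show ?thesis using flow by (metis zero_less_one)
  qed (use T_pos in simp)
  then show "\<exists>l. (wt \<longlongrightarrow> l) (end_time T)"
    and "\<exists>\<epsilon>::real>0. \<exists>W. (\<forall>t\<in>time_dom T. W t = w t) \<and> (\<forall>t\<in>time_dom (T + ereal \<epsilon>).
      (W has_vector_derivative - pullback_gradient \<sigma> gL (W t)) (at t within time_dom (T + ereal \<epsilon>)))"
    by blast+
qed

end

section \<open>Bounded Bregman balls\<close>

lemma infinity_in_infinite_ends:
  assumes "\<not> bdd_above D"
  shows "\<infinity> \<in> infinite_ends D"
proof -
  have "\<exists>d\<in>D. ereal (real n) \<le> ereal d" for n :: nat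
    using assms by (metis bdd_above.I ereal_less_eq(3) linear)
  then have "(SUP d\<in>D. ereal d) = \<infinity>" by (rule SUP_PInfty)
  then show ?thesis by (simp add: infinite_ends_def)
qed

lemma minus_infinity_in_infinite_ends:
  assumes "\<not> bdd_below D"
  shows "- \<infinity> \<in> infinite_ends D"
proof -
  have "Inf (ereal ` D) = - \<infinity>"
  proof (cases "Inf (ereal ` D)")
    case (real r)
    then have "r \<le> d" if "d \<in> D" for d
      using Inf_lower[of "ereal d" "ereal ` D"] that by simp
    then show ?thesis using assms by (auto simp: bdd_below_def)
  next
    case PInf
    then have "D = {}" using Inf_lower[of _ "ereal ` D"] by fastforce
    then show ?thesis using assms by simp
  qed
  then show ?thesis by (simp add: infinite_ends_def)
qed

text \<open>As all summands of the divergence are nonnegative, each coordinate lies in a sublevel set of the scalar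
  divergence.\<close>

lemma (in reparametrization) bounded_bregman_balls:
  fixes x :: "real ^ 'n"
  assumes div: "(\<lambda>z. z * inv_deriv_sq \<sigma> z) \<in> divergent_class D" and x: "x \<in> vecs_in D"
  shows "bounded (bregman_ball (vecs_in D) (sum_potential H) x r)"
proof -
  let ?f = "\<lambda>z. z * inv_deriv_sq \<sigma> z"
  have "bounded {q \<in> D. scalar_bregman h H (x $ i) q \<le> r}" for i
  proof (rule scalar_bregman_sublevel_bounded[where k = "inv_deriv_sq \<sigma>"])
    show "?f integrable_on {a..b}" if "a \<in> D" "b \<in> D" for a b
      using div D_Icc[OF that]
      by (auto simp: divergent_class_def L1_loc_def intro!: set_lebesgue_integral_eq_integral(1))
    show "filterlim (\<lambda>\<beta>. \<bar>integral {z..\<beta>} ?f\<bar>) at_top at_top" if "\<not> bdd_above D" "z \<in> D" for z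
    proof -
      have "filterlim (\<lambda>\<beta>. \<bar>integral {min z \<beta>..max z \<beta>} ?f\<bar>) at_top at_top"
        using div infinity_in_infinite_ends[OF that(1)] that(2)
        by (fastforce simp: divergent_class_def divergent_at_def)
      moreover have "\<forall>\<^sub>F \<beta> in at_top. \<bar>integral {min z \<beta>..max z \<beta>} ?f\<bar> = \<bar>integral {z..\<beta>} ?f\<bar>"
        using eventually_ge_at_top[of z] by eventually_elim (simp add: min_def max_def)
      ultimately show ?thesis by (rule filterlim_mono_eventually[OF _ order_refl order_refl])
    qed
    show "filterlim (\<lambda>\<beta>. \<bar>integral {\<beta>..z} ?f\<bar>) at_top at_bot" if "\<not> bdd_below D" "z \<in> D" for z
    proof -
      have "filterlim (\<lambda>\<beta>. \<bar>integral {min z \<beta>..max z \<beta>} ?f\<bar>) at_top at_bot"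
        using div minus_infinity_in_infinite_ends[OF that(1)] that(2)
        by (fastforce simp: divergent_class_def divergent_at_def)
      moreover have "\<forall>\<^sub>F \<beta> in at_bot. \<bar>integral {min z \<beta>..max z \<beta>} ?f\<bar> = \<bar>integral {\<beta>..z} ?f\<bar>"
        using eventually_le_at_bot[of z] by eventually_elim (simp add: min_def max_def)
      ultimately show ?thesis by (rule filterlim_mono_eventually[OF _ order_refl order_refl])
    qed
    show "x $ i \<in> D" using x by (simp add: vecs_in_def)
  qed (use h_integral in \<open>auto simp: inv_deriv_sq_def\<close>)
  then have "\<exists>B. \<forall>q\<in>D. scalar_bregman h H (x $ i) q \<le> r \<longrightarrow> \<bar>q\<bar> \<le> B" for i
    unfolding bounded_real by blast
  then obtain B where B: "\<And>i q. q \<in> D \<Longrightarrow> scalar_bregman h H (x $ i) q \<le> r \<Longrightarrow> \<bar>q\<bar> \<le> B i"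
    by metis
  have "norm z \<le> (\<Sum>i\<in>UNIV. B i)" if "z \<in> bregman_ball (vecs_in D) (sum_potential H) x r" for z
  proof -
    have z: "z \<in> vecs_in D" "vec_bregman x z \<le> r"
      using that bregman_sum_potential[of z x] by (auto simp: bregman_ball_def)
    have "\<bar>z $ i\<bar> \<le> B i" for i
      using B[of "z $ i" i] scalar_le_vec_bregman[OF x z(1), of i] z by (auto simp: vecs_in_def)
    then show ?thesis
      using norm_le_l1_cart[of z] sum_mono[of UNIV "\<lambda>i. \<bar>z $ i\<bar>" B] by simp
  qed
  then show ?thesis by (auto simp: bounded_iff)
qed

section \<open>The gradient of the loss\<close>

lemma output_loss_C1:
  fixes y :: "real ^ 'm"
  assumes "\<sigma>link C1_differentiable_on UNIV" "continuously_differentiable L"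
  obtains g where "\<And>v. GDERIV (output_loss \<sigma>link L y) v :> g v" "continuous_on UNIV g"
proof -
  obtain gL where gL: "\<And>p. GDERIV L p :> gL p" "continuous_on UNIV gL"
    using assms(2) by (auto simp: continuously_differentiable_def)
  note link = C1_differentiable_on_UNIV_deriv[OF assms(1)]
  have partial: "GDERIV (\<lambda>u. L (u, y)) u :> fst (gL (u, y))" for u
  proof -
    have "((\<lambda>u. (u, y)) has_derivative (\<lambda>d. (d, 0))) (at u)"
      by (auto intro!: derivative_eq_intros)
    from has_derivative_compose[OF this gL(1)[unfolded gderiv_def]]
    show ?thesis by (simp add: gderiv_def inner_prod_def)
  qed
  show ?thesis
  proof (rule that)
    show "GDERIV (output_loss \<sigma>link L y) v :> pullback_gradient \<sigma>link (\<lambda>u. fst (gL (u, y))) v" for v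
      using GDERIV_entrywise_compose[where g = "\<lambda>u. L (u, y)" and g' = "\<lambda>u. fst (gL (u, y))",
          OF link(1) partial] by (simp add: output_loss_def[abs_def])
    have "continuous_on UNIV \<sigma>link"
      using link(1) DERIV_isCont by (auto simp: continuous_on_eq_continuous_at)
    moreover have "continuous_on UNIV (\<lambda>u. fst (gL (u, y)))"
      by (rule continuous_on_fst[OF continuous_on_compose2[OF gL(2) _ subset_UNIV]])
         (auto intro!: continuous_intros)
    ultimately show "continuous_on UNIV (pullback_gradient \<sigma>link (\<lambda>u. fst (gL (u, y))))"
      using link(2) by (intro continuous_on_pullback_gradient)
  qed
qed

lemma GDERIV_matrix_compose:
  fixes A :: "real ^ 'n ^ 'm"
  assumes "GDERIV f (A *v z) :> g"
  shows "GDERIV (\<lambda>z. f (A *v z)) z :> transpose A *v g"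
proof -
  have "((\<lambda>z. A *v z) has_derivative (\<lambda>d. A *v d)) (at z)"
    by (simp add: bounded_linear_imp_has_derivative matrix_vector_mul_bounded_linear)
  from has_derivative_compose[OF this assms[unfolded gderiv_def]]
  have "((\<lambda>z. f (A *v z)) has_derivative (\<lambda>d. inner (A *v d) g)) (at z)" .
  moreover have "inner (A *v d) g = inner d (transpose A *v g)" for d
    by (metis dot_lmul_matrix inner_commute transpose_matrix_vector)
  ultimately show ?thesis by (simp add: gderiv_def)
qed

lemma convex_on_matrix_compose:
  fixes A :: "real ^ 'n ^ 'm"
  assumes "convex_on UNIV f"
  shows "convex_on UNIV (\<lambda>z. f (A *v z))"
proof (rule convex_onI)
  fix t x y assume "0 < t" "t < (1::real)"
  then show "f (A *v ((1 - t) *\<^sub>R x + t *\<^sub>R y)) \<le> (1 - t) * f (A *v x) + t * f (A *v y)"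
    using convex_onD[OF assms, of t "A *v x" "A *v y"]
    by (simp add: matrix_vector_right_distrib matrix_vector_mult_scaleR)
qed simp

lemma PL_inequality_zero_min:
  assumes "PL_inequality f \<mu>" "\<And>z. 0 \<le> f z" "f z0 = 0" "GDERIV f z :> g"
  shows "2 * \<mu> * f z \<le> (norm g)\<^sup>2"
proof -
  obtain m where m: "is_minimum f m" "\<And>z. 2 * \<mu> * (f z - m) \<le> (norm (gradient f z))\<^sup>2"
    using assms(1) by (auto simp: PL_inequality_def)
  have "m = 0" using m(1) assms(2,3) by (metis is_minimum_def antisym)
  then show ?thesis using m(2)[of z] GDERIV_imp_gradient[OF assms(4)] by simp
qed

section \<open>Convergence of the reparametrized gradient flow\<close>

theorem theorem2p7:
  fixes A :: "real ^ 'n ^ 'm" and y :: "real ^ 'm"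
    and \<sigma>rp \<sigma>link :: "real \<Rightarrow> real" and D :: "real set"
    and L :: "(real ^ 'm) \<times> (real ^ 'm) \<Rightarrow> real"
    and z0 w0 :: "real ^ 'n" and T :: ereal
    and w wt :: "real \<Rightarrow> real ^ 'n"
    and h H :: "real \<Rightarrow> real" and F :: "real ^ 'n \<Rightarrow> real"
    and Lt :: "real ^ 'n \<Rightarrow> real" and Lw :: "real ^ 'n \<Rightarrow> real"
  assumes A1: "\<sigma>link C1_differentiable_on UNIV" "inj \<sigma>link" "y \<in> range (entrywise \<sigma>link)"
    and A2: "is_interval D" "bij_betw \<sigma>rp UNIV D" "\<sigma>rp C1_differentiable_on UNIV"
      "AE x in lebesgue. deriv \<sigma>rp x \<noteq> 0"
      "AE z in lebesgue. z \<in> D \<longrightarrow> inv \<sigma>rp differentiable (at z)"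
      "inv_deriv_sq \<sigma>rp \<in> L1_loc D"
    and A3: "continuously_differentiable L" "\<And>z'. convex_on UNIV (\<lambda>z. L (z, z'))"
      "is_minimum L 0" "\<And>z z'. L (z, z') = 0 \<longleftrightarrow> z = z'"
    and A4: "z0 \<in> vecs_in D" "entrywise \<sigma>link (A *v z0) = y"
    and A5: "convex_on UNIV (output_loss \<sigma>link L y)"
    and Lw_def: "Lw = param_loss A \<sigma>rp \<sigma>link L y"
    and Lt_def: "Lt = reduced_loss A \<sigma>link L y"
    and T: "0 < T"
    and w: "gradient_flow_solution Lw w0 T w" "regular_solution \<sigma>rp T w"
    and wt_def: "wt = (\<lambda>t. entrywise \<sigma>rp (w t))"
    and h: "cont_antiderivative D (inv_deriv_sq \<sigma>rp) h"
    and H: "\<And>z. z \<in> D \<Longrightarrow> (H has_real_derivative h z) (at z within D)"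
    and F_def: "F = sum_potential H"
  shows
    "(bregman_ext (vecs_in D) F z0 (entrywise \<sigma>rp w0) < \<infinity> \<and>
      (\<forall>t\<in>time_dom T. 0 < t \<longrightarrow>
         ereal (Lt (wt t)) \<le> bregman_ext (vecs_in D) F z0 (entrywise \<sigma>rp w0) / ereal t) \<and>
      (T = \<infinity> \<longrightarrow> ((\<lambda>t. Lt (wt t)) \<longlongrightarrow> 0) at_top))
     \<and>
     (\<forall>\<mu> r t0 t1.
        0 < r \<and> t0 \<in> time_dom T \<and> (0 \<le> t1 \<and> t1 < T \<or> t1 = \<infinity>) \<and>
        {t. t0 \<le> t \<and> ereal t < t1} \<inter> critical_times \<sigma>rp T w = {} \<and>
        (\<forall>t\<in>time_dom T. t0 \<le> t \<and> ereal t < t1 \<longrightarrow> (\<forall>i. r \<le> 1 / inv_deriv_sq \<sigma>rp (wt t $ i))) \<longrightarrow>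
          (PL_inequality (output_loss \<sigma>link L y) \<mu> \<longrightarrow>
             (\<forall>\<kappa>\<ge>0. (\<forall>u. \<kappa> * (norm u)\<^sup>2 \<le> (norm (transpose A *v u))\<^sup>2) \<longrightarrow>
               (\<forall>t\<in>time_dom T. t0 \<le> t \<and> ereal t < t1 \<longrightarrow>
                  Lt (wt t) \<le> Lt (wt t0) * exp (- 2 * r * (\<kappa> * \<mu>) * (t - t0))))) \<and>
          (PL_inequality Lt \<mu> \<longrightarrow>
             (\<forall>t\<in>time_dom T. t0 \<le> t \<and> ereal t < t1 \<longrightarrow>
                Lt (wt t) \<le> Lt (wt t0) * exp (- 2 * r * \<mu> * (t - t0)))))
     \<and>
     (bounded (wt ` time_dom T) \<longrightarrow>
        (\<exists>wT. (wt \<longlongrightarrow> wT) (end_time T) \<and>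
              (wT \<in> frontier (vecs_in D) \<and> maximal_solution Lw w0 T w \<or>
               extendable_solution Lw w0 T w)))
     \<and>
     (T = \<infinity> \<and> bounded (wt ` time_dom T) \<longrightarrow>
        (\<exists>winf \<in> closure (vecs_in D). (wt \<longlongrightarrow> winf) at_top \<and> Lt winf = 0))
     \<and>
     (\<not> bounded D \<longrightarrow>
        ((\<forall>x \<in> vecs_in D. \<forall>r\<ge>0. bounded (bregman_ball (vecs_in D) F x r)) \<longrightarrow>
           bounded (wt ` time_dom T)) \<and>
        ((\<lambda>z. z * inv_deriv_sq \<sigma>rp z) \<in> divergent_class D \<longrightarrow>
           (\<forall>x \<in> vecs_in D. \<forall>r\<ge>0. bounded (bregman_ball (vecs_in D) F x r))))"
proof -
  obtain gV where gV: "\<And>v. GDERIV (output_loss \<sigma>link L y) v :> gV v" "continuous_on UNIV gV"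
    using output_loss_C1[OF A1(1) A3(1)] by blast
  define gL where "gL z = transpose A *v gV (A *v z)" for z
  have Lt_eq: "Lt = (\<lambda>z. output_loss \<sigma>link L y (A *v z))"
    by (simp add: Lt_def reduced_loss_def[abs_def] output_loss_def)
  have Lw_eq: "Lw = (\<lambda>x. Lt (entrywise \<sigma>rp x))"
    by (simp add: Lw_def Lt_def param_loss_def[abs_def] reduced_loss_def)
  have Lt_gradient: "GDERIV Lt z :> gL z" for z
    unfolding Lt_eq gL_def by (rule GDERIV_matrix_compose[OF gV(1)])
  have output_nonneg: "0 \<le> output_loss \<sigma>link L y v" for v
    using A3(3) by (simp add: is_minimum_def output_loss_def)
  have output_min: "output_loss \<sigma>link L y (A *v z0) = 0"
    using A3(4) A4(2) by (simp add: output_loss_def)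
  have Lt_min: "Lt z0 = 0" by (simp add: Lt_eq output_min)
  interpret reparametrization \<sigma>rp D h H
    using A2 h H by unfold_locales
  have Lw_gradient: "gradient Lw x = pullback_gradient \<sigma>rp gL x" for x
    unfolding Lw_eq
    by (rule GDERIV_imp_gradient[OF GDERIV_entrywise_compose[where g' = gL, OF \<sigma>_deriv Lt_gradient]])
  interpret mirror_flow \<sigma>rp D h H Lt gL T w
  proof
    show "continuous_on UNIV gL"
      unfolding gL_def
      by (intro linear_continuous_on_compose[OF _ matrix_vector_mul_linear]
            continuous_on_compose2[OF gV(2) _ subset_UNIV] continuous_intros)
    show "convex_on UNIV Lt"
      unfolding Lt_eq using A5 by (rule convex_on_matrix_compose)
    show "finite (critical_times \<sigma>rp T w)"
      using w(2) by (simp add: regular_solution_def)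
    show "(w has_vector_derivative - pullback_gradient \<sigma>rp gL (w t)) (at t within time_dom T)"
      if "t \<in> time_dom T" for t
      using w(1) that by (simp add: gradient_flow_solution_def Lw_gradient)
  qed (use Lt_gradient T output_nonneg in \<open>simp_all add: Lt_eq\<close>)
  have w_0: "w 0 = w0" using w(1) by (simp add: gradient_flow_solution_def)
  have bregman_F: "bregman F x q = vec_bregman x q" if "q \<in> vecs_in D" for x q
    unfolding F_def using that by (rule bregman_sum_potential)
  have ext: "bregman_ext (vecs_in D) F z0 (entrywise \<sigma>rp w0) = ereal (vec_bregman z0 (entrywise \<sigma>rp (w 0)))"
    using A4(1) by (simp add: bregman_ext_def bregman_F w_0)

  have i: "bregman_ext (vecs_in D) F z0 (entrywise \<sigma>rp w0) < \<infinity>"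
    "\<forall>t\<in>time_dom T. 0 < t \<longrightarrow>
       ereal (Lt (wt t)) \<le> bregman_ext (vecs_in D) F z0 (entrywise \<sigma>rp w0) / ereal t"
    "T = \<infinity> \<longrightarrow> ((\<lambda>t. Lt (wt t)) \<longlongrightarrow> 0) at_top"
    using loss_le_bregman_over_time[OF A4(1) Lt_min] loss_tendsto_zero[OF A4(1) Lt_min]
    by (simp_all add: ext wt_def)

  have ii: "Lt (wt t) \<le> Lt (wt t0) * exp (- 2 * r * \<nu> * (t - t0))"
    if PL: "\<And>z. 2 * \<nu> * Lt z \<le> (norm (gL z))\<^sup>2"
      and hyps: "0 < r" "t0 \<in> time_dom T" "{t. t0 \<le> t \<and> ereal t < t1} \<inter> critical_times \<sigma>rp T w = {}"
        "\<forall>t\<in>time_dom T. t0 \<le> t \<and> ereal t < t1 \<longrightarrow> (\<forall>i. r \<le> 1 / inv_deriv_sq \<sigma>rp (wt t $ i))"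
      and t: "t \<in> time_dom T" "t0 \<le> t" "ereal t < t1" for \<nu> r t0 t1 t
    unfolding wt_def
  proof (rule exponential_decay[OF PL])
    have before: "ereal q < t1" if "q \<in> {t0..t}" for q
      using that t(3) by (meson atLeastAtMost_iff ereal_less_eq(3) le_less_trans)
    show sub: "{t0..t} \<subseteq> time_dom T"
      using atLeastAtMost_subset_time_dom[OF t(1)] hyps(2) by (simp add: time_dom_def)
    show "{t0..t} \<inter> critical_times \<sigma>rp T w = {}"
      using hyps(3) before by fastforce
    show "r \<le> 1 / inv_deriv_sq \<sigma>rp (entrywise \<sigma>rp (w q) $ i)" if "q \<in> {t0..t}" for q i
      using hyps(4) before[OF that] sub that by (auto simp: wt_def)
  qed (use hyps t in auto)
  have PL_output: "2 * (\<kappa> * \<mu>) * Lt z \<le> (norm (gL z))\<^sup>2"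
    if "PL_inequality (output_loss \<sigma>link L y) \<mu>" "0 \<le> \<kappa>"
      "\<forall>u. \<kappa> * (norm u)\<^sup>2 \<le> (norm (transpose A *v u))\<^sup>2" for \<mu> \<kappa> z
  proof -
    have "\<kappa> * (2 * \<mu> * output_loss \<sigma>link L y (A *v z)) \<le> \<kappa> * (norm (gV (A *v z)))\<^sup>2"
      using PL_inequality_zero_min[OF that(1) output_nonneg output_min gV(1)] that(2)
      by (intro mult_left_mono)
    also have "\<dots> \<le> (norm (gL z))\<^sup>2" using that(3) by (simp add: gL_def)
    finally show ?thesis by (simp add: Lt_eq mult_ac)
  qed
  have PL_reduced: "2 * \<mu> * Lt z \<le> (norm (gL z))\<^sup>2" if "PL_inequality Lt \<mu>" for \<mu> z
    using PL_inequality_zero_min[OF that Lt_nonneg Lt_min Lt_gradient] .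

  have iii: "\<exists>wT. (wt \<longlongrightarrow> wT) (end_time T) \<and>
      (wT \<in> frontier (vecs_in D) \<and> maximal_solution Lw w0 T w \<or> extendable_solution Lw w0 T w)"
    if "bounded (wt ` time_dom T)"
  proof -
    note bdd = that[unfolded wt_def]
    obtain wT where "(wt \<longlongrightarrow> wT) (end_time T)"
      using bounded_trajectory_extends(1)[OF A4(1) Lt_min bdd] unfolding wt_def by blast
    moreover have "extendable_solution Lw w0 T w"
    proof -
      obtain \<epsilon> :: real and W where "0 < \<epsilon>" and W: "\<forall>t\<in>time_dom T. W t = w t"
        "\<forall>t\<in>time_dom (T + ereal \<epsilon>). (W has_vector_derivative
           - pullback_gradient \<sigma>rp gL (W t)) (at t within time_dom (T + ereal \<epsilon>))"
        using bounded_trajectory_extends(2)[OF A4(1) Lt_min bdd] by blast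
      moreover have "gradient_flow_solution Lw w0 (T + ereal \<epsilon>) W"
        using W w_0 zero_in_time_dom[OF T] by (simp add: gradient_flow_solution_def Lw_gradient)
      ultimately show ?thesis unfolding extendable_solution_def by blast
    qed
    ultimately show ?thesis by blast
  qed

  have iv: "\<exists>winf \<in> closure (vecs_in D). (wt \<longlongrightarrow> winf) at_top \<and> Lt winf = 0"
    if infinite: "T = \<infinity>" "bounded (wt ` time_dom T)"
  proof -
    obtain l where "l \<in> vecs_in D" "((\<lambda>t. entrywise \<sigma>rp (w t)) \<longlongrightarrow> l) at_top" "Lt l = 0"
      by (rule bounded_trajectory_converges[OF A4(1) Lt_min infinite[unfolded wt_def]])
    then show ?thesis using closure_subset unfolding wt_def by blast
  qed

  have v: "bounded (wt ` time_dom T)"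
    if balls: "\<forall>x \<in> vecs_in D. \<forall>r\<ge>0. bounded (bregman_ball (vecs_in D) F x r)"
  proof (rule bounded_subset)
    show "bounded (bregman_ball (vecs_in D) F z0 (vec_bregman z0 (entrywise \<sigma>rp (w 0))))"
      using balls A4(1) by (simp add: vec_bregman_nonneg)
    show "wt ` time_dom T \<subseteq> bregman_ball (vecs_in D) F z0 (vec_bregman z0 (entrywise \<sigma>rp (w 0)))"
      using bregman_decreasing[OF A4(1) Lt_min, of 0]
      by (auto simp: bregman_ball_def bregman_F wt_def time_dom_def)
  qed
  have v': "bounded (bregman_ball (vecs_in D) F x r)"
    if "(\<lambda>z. z * inv_deriv_sq \<sigma>rp z) \<in> divergent_class D" "x \<in> vecs_in D" for x r
    unfolding F_def using that by (rule bounded_bregman_balls)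

  show ?thesis
  proof (intro conjI i, goal_cases)
    case 1
    show ?case
      by (intro allI impI conjI ballI; elim conjE; rule ii[OF PL_output] ii[OF PL_reduced], assumption+)
  next
    case 2
    show ?case using iii by blast
  next
    case 3
    show ?case using iv by blast
  next
    case 4
    show ?case using v v' by blast
  qed
qed

end
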